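(* Let $\Gamma$ be a countable group with a proper left-invariant distance such that $v=\liminf_n \frac1n\log \#B(e,n)$ is finite. Let $\mu\neq\delta_e$ be a symmetric probability measure on $\Gamma$ with finite second moment and finite entropy. Let $\tilde\ell=\ell/M_2(\mu)$ and $\tilde v=M_2(\mu)\,v$ (these are the drift and the growth for the rescaled distance $\operatorname{dist}(g,h)/M_2(\mu)$). Then $$\tilde\ell\le \tanh(\tilde v/2),\qquad h\le \tilde v\tanh(\tilde v/2),\qquad \rho\ge \frac{1}{\cosh(\tilde v/2)}.$$
   Context: A distance $\operatorname{dist}$ on $\Gamma$ is proper if all balls are finite, and left-invariant if $\operatorname{dist}(\gamma g,\gamma g')=\operatorname{dist}(g,g')$ for all $\gamma,g,g'\in\Gamma$. Write $e$ for the identity, $|g|=\operatorname{dist}(g,e)$, and $B(e,n)$ for the ball of radius $n$ about $e$. A probability measure $\mu$ on $\Gamma$ is symmetric if $\mu(g)=\mu(g^{-1})$ for all $g$. It has finite entropy if $H(\mu)=-\sum_g\mu(g)\log\mu(g)<\infty$, and finite second moment if $M_2(\mu):=\left(\sum_g|g|^2\mu(g)\right)^{1/2}<\infty$. Let $\mu^{*n}$ be the $n$-fold convolution of $\mu$. The asymptotic entropy, spectral radius and drift are $$h=\lim_n-\frac1n\sum_g\mu^{*n}(g)\log\mu^{*n}(g),\qquad \rho=\limsup_n\sqrt[n]{\mu^{*n}(e)},\qquad \ell=\lim_n\frac1n\sum_g|g|\,\mu^{*n}(g).$$ *)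

theory Defs
  imports "HOL-Probability.Probability" "HOL-Algebra.Group"
begin

text \<open>
  Since the group is countable, a probability measure on it is a \<^typ>\<open>'a pmf\<close> whose support lies
  in the carrier. Logarithms are natural.
\<close>

definition proper_dist :: "('a, 'b) monoid_scheme \<Rightarrow> ('a \<Rightarrow> 'a \<Rightarrow> real) \<Rightarrow> bool" where
  "proper_dist G d \<longleftrightarrow>
     (\<forall>x\<in>carrier G. \<forall>r. finite (Metric_space.mcball (carrier G) d x r))"

definition left_invariant_dist :: "('a, 'b) monoid_scheme \<Rightarrow> ('a \<Rightarrow> 'a \<Rightarrow> real) \<Rightarrow> bool" where
  "left_invariant_dist G d \<longleftrightarrow>
     (\<forall>k\<in>carrier G. \<forall>x\<in>carrier G. \<forall>y\<in>carrier G. d (k \<otimes>\<^bsub>G\<^esub> x) (k \<otimes>\<^bsub>G\<^esub> y) = d x y)"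

definition growth :: "('a, 'b) monoid_scheme \<Rightarrow> ('a \<Rightarrow> 'a \<Rightarrow> real) \<Rightarrow> ereal" where
  "growth G d = liminf (\<lambda>n::nat.
     ereal (ln (real (card (Metric_space.mcball (carrier G) d \<one>\<^bsub>G\<^esub> (real n)))) / real n))"

definition symmetric_pmf :: "('a, 'b) monoid_scheme \<Rightarrow> 'a pmf \<Rightarrow> bool" where
  "symmetric_pmf G \<mu> \<longleftrightarrow> (\<forall>g\<in>carrier G. pmf \<mu> g = pmf \<mu> (inv\<^bsub>G\<^esub> g))"

definition conv_pmf :: "('a, 'b) monoid_scheme \<Rightarrow> 'a pmf \<Rightarrow> 'a pmf \<Rightarrow> 'a pmf" where
  "conv_pmf G \<mu> \<nu> = map_pmf (\<lambda>(x, y). x \<otimes>\<^bsub>G\<^esub> y) (pair_pmf \<mu> \<nu>)"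

primrec conv_power :: "('a, 'b) monoid_scheme \<Rightarrow> 'a pmf \<Rightarrow> nat \<Rightarrow> 'a pmf" where
  "conv_power G \<mu> 0 = return_pmf \<one>\<^bsub>G\<^esub>"
| "conv_power G \<mu> (Suc n) = conv_pmf G \<mu> (conv_power G \<mu> n)"

text \<open>
  An infinite sum that is not summable has the value \<open>0\<close> by convention. So finiteness of the
  entropy and of the second moment is expressed by summability of their nonnegative terms.
  Summands with \<^prop>\<open>pmf \<mu> g = 0\<close> vanish, as they should.
\<close>

definition finite_entropy :: "('a, 'b) monoid_scheme \<Rightarrow> 'a pmf \<Rightarrow> bool" where
  "finite_entropy G \<mu> \<longleftrightarrow> (\<lambda>g. - (pmf \<mu> g * ln (pmf \<mu> g))) summable_on carrier G"

definition pmf_entropy :: "('a, 'b) monoid_scheme \<Rightarrow> 'a pmf \<Rightarrow> real" where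
  "pmf_entropy G \<mu> = - (\<Sum>\<^sub>\<infinity>g\<in>carrier G. pmf \<mu> g * ln (pmf \<mu> g))"

definition finite_second_moment ::
    "('a, 'b) monoid_scheme \<Rightarrow> ('a \<Rightarrow> 'a \<Rightarrow> real) \<Rightarrow> 'a pmf \<Rightarrow> bool" where
  "finite_second_moment G d \<mu> \<longleftrightarrow> (\<lambda>g. (d g \<one>\<^bsub>G\<^esub>)\<^sup>2 * pmf \<mu> g) summable_on carrier G"

definition M2 :: "('a, 'b) monoid_scheme \<Rightarrow> ('a \<Rightarrow> 'a \<Rightarrow> real) \<Rightarrow> 'a pmf \<Rightarrow> real" where
  "M2 G d \<mu> = sqrt (\<Sum>\<^sub>\<infinity>g\<in>carrier G. (d g \<one>\<^bsub>G\<^esub>)\<^sup>2 * pmf \<mu> g)"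

text \<open>
  If \<open>\<mu>\<close> has finite entropy and finite first moment, then so do its convolution powers, and the
  two limits below exist by subadditivity.
\<close>

definition asymptotic_entropy :: "('a, 'b) monoid_scheme \<Rightarrow> 'a pmf \<Rightarrow> real" where
  "asymptotic_entropy G \<mu> = lim (\<lambda>n. pmf_entropy G (conv_power G \<mu> n) / real n)"

definition drift :: "('a, 'b) monoid_scheme \<Rightarrow> ('a \<Rightarrow> 'a \<Rightarrow> real) \<Rightarrow> 'a pmf \<Rightarrow> real" where
  "drift G d \<mu> =
     lim (\<lambda>n. (\<Sum>\<^sub>\<infinity>g\<in>carrier G. d g \<one>\<^bsub>G\<^esub> * pmf (conv_power G \<mu> n) g) / real n)"

text \<open>The limsup is taken in the extended reals only because \<^typ>\<open>real\<close> is not a complete lattice.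
  All terms lie between \<open>0\<close> and \<open>1\<close>.\<close>

definition spectral_radius :: "('a, 'b) monoid_scheme \<Rightarrow> 'a pmf \<Rightarrow> real" where
  "spectral_radius G \<mu> =
     real_of_ereal (limsup (\<lambda>n. ereal (root n (pmf (conv_power G \<mu> n) \<one>\<^bsub>G\<^esub>))))"

end

theory Submission
  imports Defs "HOL-Real_Asymp.Real_Asymp"
begin

text \<open>
  Write \<open>p\<^sub>n\<close> for the law of the walk at time \<open>n\<close>, \<open>m = M2 G d \<mu>\<close>, and \<open>h\<close>, \<open>\<ell>\<close>, \<open>\<rho>\<close> for asymptotic entropy,
  drift and spectral radius. The ingredients are subadditivity, convexity and the symmetry of \<open>\<mu>\<close>.

  \<^bold>\<open>Drift and entropy.\<close> Two inequalities in opposite directions are compared. The first is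
  \<open>h \<le> \<ell> v\<close> (\<open>asymptotic_entropy_le_drift_growth\<close>): at time \<open>n\<close> the walk sits, up to small probability,
  in a ball of radius about \<open>\<ell> n\<close>, and entropy is at most the logarithm of the number of points.
  The second is \<open>h \<ge> F (\<ell> / m)\<close> with \<open>F t = t ln ((1 + t) / (1 - t))\<close>. It is an entropy production
  estimate. For a law \<open>\<nu>\<close>, let \<open>x\<close> be distributed by \<open>\<nu>\<close> and \<open>g\<close> by \<open>\<mu>\<close>, and let \<open>u = - ln \<nu>\<close>. As \<open>\<mu>\<close> is
  symmetric, the expected increments of \<open>u\<close> and of the length along the edge from \<open>x\<close> to \<open>xg\<close> are
  \<open>\<Sum> \<mu>(g) (\<nu>(x) - \<nu>(xg)) (ln \<nu>(x) - ln \<nu>(xg)) / 2\<close> and \<open>\<Sum> \<mu>(g) (\<nu>(x) - \<nu>(xg)) (\<bar>xg\<bar> - \<bar>x\<bar>) / 2\<close>.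
  With \<open>t = (\<nu>(x) - \<nu>(xg)) / (\<nu>(x) + \<nu>(xg))\<close>, the first is the mean of \<open>F t\<close> and the second at most
  the mean of \<open>\<bar>g\<bar> \<bar>t\<bar>\<close> for the probability weights \<open>\<mu>(g) (\<nu>(x) + \<nu>(xg)) / 2\<close>, so Cauchy-Schwarz and the convexity of \<open>u \<mapsto> F (sqrt u)\<close> bound
  the entropy increment from below by \<open>F\<close> of the length increment divided by \<open>m\<close>. For \<open>\<nu>\<close> one takes the
  Green measure \<open>\<nu> = (1 - a) \<Sum> a\<^sup>n p\<^sub>n\<close>: it satisfies \<open>\<nu> = (1 - a) \<delta> + a \<nu> * \<mu>\<close>, so the length increment is
  exactly \<open>(1/a - 1)\<close> times the mean length, hence at least \<open>\<ell>\<close>, and the entropy increment is at most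
  \<open>(1/a - 1)\<close> times the entropy of \<open>\<nu>\<close>, which for \<open>a \<rightarrow> 1\<close> is asymptotically at most \<open>h\<close>.
  The argument is carried out with the tangents of \<open>F\<close> at the points \<open>tanh z\<close> in place of \<open>F\<close> itself
  (\<open>entropy_drift_tangent\<close>); this spares the two applications of Jensen's inequality and any
  discussion of the case \<open>\<ell> = m\<close>, in which \<open>F\<close> is infinite. Since \<open>F (tanh z) = 2 z tanh z\<close>, comparing both
  bounds on \<open>h\<close> gives \<open>\<ell> / m \<le> tanh (m v / 2)\<close>, and then \<open>h \<le> \<ell> v\<close> gives the bound on \<open>h\<close>.

  \<^bold>\<open>Spectral radius.\<close> The Rayleigh quotients of the convolution operator on finitely supported
  functions are at most \<open>\<rho>\<close> (\<open>rayleigh_quotient_le_spectral_radius\<close>). The test function is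
  \<open>f(x) = exp (- s \<bar>x\<bar>)\<close> cut off at a ball, with \<open>s > v / 2\<close>. Because
  \<open>2 f(x) f(y) / (f(x)\<^sup>2 + f(y)\<^sup>2) = 1 / cosh (s (\<bar>x\<bar> - \<bar>y\<bar>))\<close>, its Rayleigh quotient is, up to a boundary term,
  at least the mean of \<open>1 / cosh (s \<bar>g\<bar>)\<close>, which is at least \<open>1 / cosh (s m)\<close> by the convexity of
  \<open>u \<mapsto> 1 / cosh (sqrt u)\<close>. The boundary term is small for suitable balls (\<open>exists_thin_shell\<close>), since
  otherwise all large balls would have at least \<open>const * exp (2 s n)\<close> elements.
\<close>

section \<open>Subadditive sequences\<close>

text \<open>
  Writing \<open>n = q m + r\<close> with \<open>r < m\<close> gives \<open>a n / n \<le> a m / m + O(1/n)\<close>, so the limit exists and is the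
  infimum. That the infimum is a lower bound at every time is used throughout.
\<close>
lemma fekete:
  fixes a :: "nat \<Rightarrow> real"
  assumes sub: "\<And>m n. a (m + n) \<le> a m + a n" and nonneg: "\<And>n. 0 \<le> a n"
  obtains L where "(\<lambda>n. a n / real n) \<longlonglongrightarrow> L" and "\<And>n. n > 0 \<Longrightarrow> L \<le> a n / real n"
proof -
  define S where "S = (\<lambda>n. a n / real n) ` {0<..}"
  define L where "L = Inf S"
  have bdd: "bdd_below S" unfolding S_def using nonneg by (intro bdd_belowI2[where m=0]) simp
  have lower: "L \<le> a n / real n" if "n > 0" for n
    unfolding L_def using that bdd by (intro cInf_lower) (auto simp: S_def)
  have mult: "a (q * m + r) \<le> real q * a m + a r" for q m r
  proof (induction q)
    case (Suc q)
    have "a (Suc q * m + r) \<le> a m + a (q * m + r)" using sub[of m "q * m + r"] by (simp add: add.assoc)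
    with Suc show ?case by (simp add: algebra_simps)
  qed simp
  have "(\<lambda>n. a n / real n) \<longlonglongrightarrow> L"
  proof (rule LIMSEQ_I)
    fix e :: real assume e: "e > 0"
    have "S \<noteq> {}" by (auto simp: S_def)
    then obtain m where m: "m > 0" "a m / real m < L + e / 2"
      using cInf_lessD[of S "L + e / 2"] e unfolding L_def S_def by auto
    define K where "K = (\<Sum>r<m. a r)"
    have K: "a r \<le> K" if "r < m" for r
      unfolding K_def using that nonneg by (intro member_le_sum) auto
    obtain N where N: "real N > 2 * K / e" using reals_Archimedean2 by blast
    show "\<exists>N. \<forall>n\<ge>N. norm (a n / real n - L) < e"
    proof (intro exI allI impI)
      fix n assume n: "n \<ge> Suc N"
      have "a n \<le> real (n div m) * a m + a (n mod m)"
        using mult[of "n div m" m "n mod m"] by simp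
      also have "\<dots> \<le> (real n / real m) * a m + K"
        using m nonneg K[of "n mod m"] by (intro add_mono mult_right_mono) (auto simp: of_nat_div_le_of_nat)
      finally have "a n / real n \<le> a m / real m + K / real n"
        using n m by (simp add: field_simps)
      moreover have "K / real n < e / 2"
      proof -
        have "2 * K / e < real n" using N n by linarith
        then show ?thesis using n e by (simp add: field_simps)
      qed
      ultimately have "a n / real n < L + e" using m by linarith
      moreover have "L \<le> a n / real n" using lower n by simp
      ultimately show "norm (a n / real n - L) < e" by simp
    qed
  qed
  then show ?thesis using that lower by blast
qed

lemma subadditive_le_mult:
  fixes a :: "nat \<Rightarrow> real"
  assumes sub: "\<And>m n. a (m + n) \<le> a m + a n" and zero: "a 0 = 0"
  shows "a n \<le> real n * a 1"
proof (induction n)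
  case (Suc n)
  have "a (Suc n) \<le> a 1 + a n" using sub[of 1 n] by simp
  then show ?case using Suc by (simp add: algebra_simps)
qed (simp add: zero)

section \<open>Inequalities for hyperbolic functions\<close>

lemma one_minus_tanh_square: "1 - tanh x ^ 2 = 1 / cosh x ^ 2" for x :: real
proof -
  have "cosh x ^ 2 - sinh x ^ 2 = 1" using cosh_square_eq[of x] by simp
  then show ?thesis using cosh_real_pos[of x] by (simp add: tanh_def power_divide divide_simps)
qed

text \<open>
  The derivative has the sign of \<open>x / cosh\<^sup>2 x - tanh x\<close>, and \<open>x \<le> sinh x \<le> sinh x cosh x\<close>. Both convexity
  statements below reduce to this monotonicity.
\<close>
lemma tanh_div_antimono:
  fixes y z :: real assumes "0 < y" "y \<le> z" shows "tanh z / z \<le> tanh y / y"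
proof (rule DERIV_nonpos_imp_nonincreasing[OF assms(2)])
  fix x :: real assume x: "y \<le> x" "x \<le> z"
  then have x0: "x > 0" using assms by simp
  have "((\<lambda>x. tanh x / x) has_real_derivative ((1 - tanh x ^ 2) * x - tanh x) / (x * x)) (at x)"
    using x0 by (auto intro!: derivative_eq_intros simp: cosh_real_pos less_imp_neq[symmetric])
  moreover have "(1 - tanh x ^ 2) * x \<le> tanh x"
  proof -
    have "x \<le> cosh x * sinh x"
    proof -
      have "x \<le> sinh x" 
      proof -
        have "(\<lambda>y::real. sinh y - y) 0 \<le> (\<lambda>y. sinh y - y) x"
        proof (rule DERIV_nonneg_imp_nondecreasing[OF less_imp_le[OF x0]])
          fix t :: real assume "0 \<le> t" "t \<le> x"
          then show "\<exists>D. ((\<lambda>y. sinh y - y) has_real_derivative D) (at t) \<and> 0 \<le> D"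
            by (intro exI[of _ "cosh t - 1"]) (auto intro!: derivative_eq_intros cosh_real_ge_1)
        qed
        then show ?thesis by simp
      qed
      also have "sinh x \<le> cosh x * sinh x" using x0 cosh_real_ge_1[of x] by simp
      finally show ?thesis .
    qed
    then show ?thesis using cosh_real_pos[of x]
      unfolding one_minus_tanh_square by (simp add: tanh_def divide_simps power2_eq_square mult.commute)
  qed
  ultimately show "\<exists>D. ((\<lambda>x. tanh x / x) has_real_derivative D) (at x) \<and> D \<le> 0"
    using x0 by (intro exI conjI) (auto intro!: divide_nonpos_pos)
qed

lemma minimum_on_half_line:
  fixes f f' :: "real \<Rightarrow> real"
  assumes der: "\<And>x. 0 \<le> x \<Longrightarrow> (f has_real_derivative f' x) (at x)"
    and before: "\<And>x. 0 \<le> x \<Longrightarrow> x \<le> z \<Longrightarrow> f' x \<le> 0"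
    and after: "\<And>x. z \<le> x \<Longrightarrow> 0 \<le> f' x"
    and "0 \<le> z" "0 \<le> y"
  shows "f z \<le> f y"
proof (cases "y \<le> z")
  case True
  show ?thesis
    by (rule DERIV_nonpos_imp_nonincreasing[OF True]) (use assms in \<open>meson order_trans\<close>)
next
  case False
  then have "z \<le> y" by simp
  then show ?thesis
    by (rule DERIV_nonneg_imp_nondecreasing) (use assms in \<open>meson order_trans\<close>)
qed

text \<open>
  The derivative of \<open>G(u) = sqrt u * artanh (sqrt u)\<close> at \<open>u = tanh\<^sup>2 z\<close>.
\<close>
definition entropy_slope :: "real \<Rightarrow> real" where
  "entropy_slope z = (z / tanh z + cosh z ^ 2) / 2"

text \<open>
  The function \<open>G(u) = sqrt u * artanh (sqrt u)\<close>, which is half of \<open>F (sqrt u)\<close> with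
  \<open>F t = t ln ((1 + t) / (1 - t))\<close>, is convex and lies above its tangent at
  \<open>tanh\<^sup>2 z\<close>. In the variable \<open>y = artanh (sqrt u)\<close>, the difference has a derivative with the sign of
  \<open>(y / tanh y + cosh\<^sup>2 y) - (z / tanh z + cosh\<^sup>2 z)\<close>, and both summands are increasing in \<open>y\<close>.
\<close>
lemma mult_tanh_tangent:
  fixes y z :: real
  assumes z: "0 < z"
  shows "z * tanh z + entropy_slope z * (tanh y ^ 2 - tanh z ^ 2) \<le> y * tanh y"
proof -
  define c where "c = entropy_slope z"
  define \<phi> where "\<phi> = (\<lambda>x. x * tanh x - c * tanh x ^ 2)"
  define q where "q x = (tanh x / cosh x ^ 2) * (x / tanh x + cosh x ^ 2 - 2 * c)" for x
  have mono: "x / tanh x + cosh x ^ 2 \<le> x' / tanh x' + cosh x' ^ 2" if "0 < x" "x \<le> x'" for x x' :: real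
  proof -
    have "x / tanh x \<le> x' / tanh x'"
      using tanh_div_antimono[OF that] that by (simp add: field_simps)
    moreover have "cosh x \<le> cosh x'" using that by (simp add: cosh_real_nonneg_le_iff)
    ultimately show ?thesis using cosh_real_nonneg[of x] by (intro add_mono power_mono)
  qed
  have c: "2 * c = z / tanh z + cosh z ^ 2" by (simp add: c_def entropy_slope_def)
  have der: "(\<phi> has_real_derivative q x) (at x)" if "0 \<le> x" for x
  proof -
    have "(\<phi> has_real_derivative tanh x + x * (1 - tanh x ^ 2) - c * (2 * tanh x * (1 - tanh x ^ 2))) (at x)"
      unfolding \<phi>_def by (auto intro!: derivative_eq_intros simp: cosh_real_pos less_imp_neq[symmetric])
    also have "tanh x + x * (1 - tanh x ^ 2) - c * (2 * tanh x * (1 - tanh x ^ 2)) = q x"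
    proof (cases "x = 0")
      case False
      then have "tanh x \<noteq> 0" by simp
      then show ?thesis unfolding one_minus_tanh_square q_def using cosh_real_pos[of x]
        by (simp add: field_simps)
    qed (simp add: q_def)
    finally show ?thesis .
  qed
  have "\<phi> z \<le> \<phi> \<bar>y\<bar>"
  proof (rule minimum_on_half_line[OF der])
    fix x assume "0 \<le> x" "x \<le> z"
    then show "q x \<le> 0"
      using mono[of x z] c unfolding q_def
      by (cases "x = 0") (auto simp del: times_divide_eq_left intro!: mult_nonneg_nonpos)
  next
    fix x assume "z \<le> x"
    then show "0 \<le> q x"
      using mono[of z x] c z by (auto simp: q_def intro!: mult_nonneg_nonneg)
  qed (use z in auto)
  moreover have "\<phi> \<bar>y\<bar> = \<phi> y" by (simp add: \<phi>_def abs_if)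
  ultimately show ?thesis by (simp add: \<phi>_def c_def algebra_simps)
qed

text \<open>
  The function \<open>u \<mapsto> 1 / cosh (sqrt u)\<close> is convex and lies above its tangent at \<open>z\<^sup>2\<close>: in the variable
  \<open>y = sqrt u\<close> the derivative of the difference is \<open>y (\<kappa>(z) - \<kappa>(y))\<close> with the decreasing function
  \<open>\<kappa>(y) = (tanh y / y) / cosh y\<close>.
\<close>
lemma sech_tangent:
  fixes y z :: real
  assumes z: "0 < z"
  shows "1 / cosh z - tanh z / (2 * z * cosh z) * (y ^ 2 - z ^ 2) \<le> 1 / cosh y"
proof -
  define \<kappa> where "\<kappa> = (\<lambda>x::real. tanh x / x * (1 / cosh x))"
  define \<phi> where "\<phi> = (\<lambda>x. 1 / cosh x + \<kappa> z / 2 * x ^ 2)"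
  define q where "q x = x * (\<kappa> z - \<kappa> x)" for x
  have mono: "\<kappa> x' \<le> \<kappa> x" if "0 < x" "x \<le> x'" for x x' :: real
    unfolding \<kappa>_def
  proof (rule mult_mono[OF tanh_div_antimono[OF that]])
    have "cosh x \<le> cosh x'" using that by (simp add: cosh_real_nonneg_le_iff)
    then show "1 / cosh x' \<le> 1 / cosh x" using cosh_real_pos[of x] by (simp add: frac_le)
  qed (use that in auto)
  have der: "(\<phi> has_real_derivative q x) (at x)" if "0 \<le> x" for x
  proof -
    have "(\<phi> has_real_derivative - sinh x / (cosh x * cosh x) + \<kappa> z / 2 * (2 * x)) (at x)"
      unfolding \<phi>_def by (auto intro!: derivative_eq_intros simp: cosh_real_pos less_imp_neq[symmetric])
    also have "- sinh x / (cosh x * cosh x) + \<kappa> z / 2 * (2 * x) = q x"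
      by (cases "x = 0") (auto simp: q_def \<kappa>_def tanh_def field_simps)
    finally show ?thesis .
  qed
  have "\<phi> z \<le> \<phi> \<bar>y\<bar>"
  proof (rule minimum_on_half_line[OF der])
    fix x assume "0 \<le> x" "x \<le> z"
    then show "q x \<le> 0"
      using mono[of x z] by (cases "x = 0") (auto simp: q_def intro!: mult_nonneg_nonpos)
  next
    fix x assume "z \<le> x"
    then show "0 \<le> q x"
      using mono[of z x] z by (auto simp: q_def intro!: mult_nonneg_nonneg)
  qed (use z in auto)
  moreover have "\<phi> \<bar>y\<bar> = \<phi> y" by (simp add: \<phi>_def abs_if)
  ultimately have "1 / cosh z - \<kappa> z / 2 * (y ^ 2 - z ^ 2) \<le> 1 / cosh y"
    by (simp add: \<phi>_def algebra_simps)
  moreover have "\<kappa> z / 2 = tanh z / (2 * z * cosh z)" by (simp add: \<kappa>_def)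
  ultimately show ?thesis by simp
qed

text \<open>
  With \<open>y = (ln A - ln B) / 2\<close> one has \<open>A - B = (A + B) tanh y\<close>, so the right-hand side is
  \<open>(A + B) y tanh y\<close> and the tangent inequality applies. The quadratic term \<open>tanh\<^sup>2 y\<close> is then linearised
  by \<open>(tanh y - e tanh z)\<^sup>2 \<ge> 0\<close>, which is the pointwise form of Cauchy-Schwarz. In the application \<open>A\<close>
  and \<open>B\<close> are the masses of the end points of an edge, \<open>e\<close> is the difference of their lengths
  and \<open>c\<close> the length of the edge, both divided by \<open>M2 G d \<mu>\<close>.
\<close>
lemma ln_difference_tangent:
  fixes A B z e c :: real
  assumes A: "0 < A" and B: "0 < B" and z: "0 < z" and e: "\<bar>e\<bar> \<le> c"
  shows "(A + B) * (z * tanh z - entropy_slope z * tanh z ^ 2 * (1 + c ^ 2)) + 2 * entropy_slope z * tanh z * ((A - B) * e)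
    \<le> (A - B) * (ln A - ln B) / 2"
proof -
  define y where "y = (ln A - ln B) / 2"
  define t where "t = tanh y"
  define s where "s = tanh z"
  define k where "k = entropy_slope z"
  have k: "0 \<le> k" using z by (simp add: k_def entropy_slope_def)
  have "exp (- 2 * y) = B / A"
  proof -
    have "- 2 * y = ln B - ln A" by (simp add: y_def)
    then show ?thesis using A B by (simp add: exp_diff)
  qed
  then have "t = (1 - B / A) / (1 + B / A)" by (simp add: t_def tanh_real_altdef)
  also have "1 - B / A = (A - B) / A" using A by (simp add: diff_divide_distrib)
  also have "1 + B / A = (A + B) / A" using A by (simp add: add_divide_distrib)
  also have "(A - B) / A / ((A + B) / A) = (A - B) / (A + B)" using A by simp
  finally have AB: "A - B = (A + B) * t" using A B by simp
  have "z * s + k * (t ^ 2 - s ^ 2) \<le> y * t"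
    unfolding s_def k_def t_def by (rule mult_tanh_tangent[OF z])
  moreover have "0 \<le> k * (t ^ 2 + s ^ 2 * c ^ 2 - 2 * s * t * e)"
  proof (rule mult_nonneg_nonneg[OF k])
    have "e ^ 2 \<le> c ^ 2" using e by (rule abs_le_square_iff[THEN iffD1, OF order_trans]) simp
    then have "s ^ 2 * e ^ 2 \<le> s ^ 2 * c ^ 2" by (rule mult_left_mono) simp
    moreover have "0 \<le> (t - s * e) ^ 2" by simp
    ultimately show "0 \<le> t ^ 2 + s ^ 2 * c ^ 2 - 2 * s * t * e"
      by (simp add: power2_diff power_mult_distrib mult_ac)
  qed
  ultimately have "z * s - k * s ^ 2 * (1 + c ^ 2) + 2 * k * s * (t * e) \<le> t * y"
    by (simp add: algebra_simps)
  then have "(A + B) * (z * s - k * s ^ 2 * (1 + c ^ 2) + 2 * k * s * (t * e)) \<le> (A + B) * (t * y)"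
    using A B by (intro mult_left_mono) auto
  moreover have "(A + B) * (t * y) = (A - B) * (ln A - ln B) / 2" by (simp add: AB y_def)
  ultimately show ?thesis
    unfolding AB s_def[symmetric] k_def[symmetric] by (simp add: algebra_simps)
qed

text \<open>
  For \<open>f(x) = exp (- s x)\<close>, the ratio of \<open>f(p) f(q)\<close> to the mean of \<open>f(p)\<^sup>2\<close> and \<open>f(q)\<^sup>2\<close> is exactly
  \<open>1 / cosh (s (p - q))\<close>.
\<close>
lemma exp_product_ge:
  fixes p q c s :: real
  assumes "\<bar>p - q\<bar> \<le> c" "0 \<le> s"
  shows "(exp (- s * p) ^ 2 + exp (- s * q) ^ 2) / (2 * cosh (s * c)) \<le> exp (- s * p) * exp (- s * q)"
proof -
  have "cosh (s * (p - q)) = cosh \<bar>s * (p - q)\<bar>" by simp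
  also have "\<dots> \<le> cosh (s * c)"
    using assms by (subst cosh_real_nonneg_le_iff) (auto simp: abs_mult mult_left_mono)
  finally have le: "cosh (s * (p - q)) \<le> cosh (s * c)" .
  have "exp (- s * p) ^ 2 + exp (- s * q) ^ 2 = exp (- s * p) * exp (- s * q) * (2 * cosh (s * (p - q)))"
    by (simp add: cosh_def power2_eq_square exp_add[symmetric] algebra_simps)
  also have "\<dots> \<le> exp (- s * p) * exp (- s * q) * (2 * cosh (s * c))"
    using le by (intro mult_left_mono) auto
  finally show ?thesis using cosh_real_pos[of "s * c"] by (simp add: pos_divide_le_eq)
qed

section \<open>Sums against probability mass functions\<close>

text \<open>
  These two facts translate the sums of the statement into expectations. The second holds without
  a summability condition, since both sides are \<open>0\<close> if the sum diverges.
\<close>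
lemma
  fixes f :: "'a \<Rightarrow> real"
  assumes "set_pmf q \<subseteq> C"
  shows summable_on_pmf_iff: "(\<lambda>x. f x * pmf q x) summable_on C \<longleftrightarrow> integrable (measure_pmf q) f"
    and infsum_pmf: "(\<Sum>\<^sub>\<infinity>x\<in>C. f x * pmf q x) = measure_pmf.expectation q f"
proof -
  let ?g = "\<lambda>x. f x * pmf q x"
  have zero: "?g x = 0" if "x \<notin> C" for x
    using that assms by (auto simp: set_pmf_iff)
  have iff: "Infinite_Set_Sum.abs_summable_on ?g C \<longleftrightarrow> integrable (measure_pmf q) f"
  proof -
    have "Infinite_Set_Sum.abs_summable_on ?g C \<longleftrightarrow> Infinite_Set_Sum.abs_summable_on ?g UNIV"
      by (rule abs_summable_on_cong_neutral) (simp_all add: zero)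
    also have "\<dots> \<longleftrightarrow> integrable (measure_pmf q) f"
      unfolding abs_summable_on_def measure_pmf_eq_density
      by (subst integrable_density) (simp_all add: mult.commute)
    finally show ?thesis .
  qed
  have iff': "?g summable_on C \<longleftrightarrow> Infinite_Set_Sum.abs_summable_on ?g C"
    by (rule trans[OF summable_on_iff_abs_summable_on_real abs_summable_equivalent])
  show "?g summable_on C \<longleftrightarrow> integrable (measure_pmf q) f"
    using iff iff' by simp
  show "infsum ?g C = measure_pmf.expectation q f"
  proof (cases "integrable (measure_pmf q) f")
    case True
    have "infsum ?g C = infsetsum ?g C"
      using True iff by (simp add: infsetsum_infsum)
    also have "\<dots> = infsetsum ?g UNIV"
      using zero by (intro infsetsum_cong_neutral) auto
    also have "\<dots> = measure_pmf.expectation q f"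
      unfolding infsetsum_def measure_pmf_eq_density
      by (subst integral_density) (auto simp: mult.commute)
    finally show ?thesis .
  next
    case False
    then have "\<not> ?g summable_on C" using iff iff' by simp
    then show ?thesis using False by (simp add: infsum_not_exists not_integrable_integral_eq)
  qed
qed

lemma
  fixes f :: "'a \<Rightarrow> real"
  shows integrable_pair_pmf_fst: "integrable (pair_pmf p q) (\<lambda>z. f (fst z)) \<longleftrightarrow> integrable p f"
    and integrable_pair_pmf_snd: "integrable (pair_pmf p q) (\<lambda>z. g (snd z)) \<longleftrightarrow> integrable q (g :: 'b \<Rightarrow> real)"
proof -
  show "integrable (pair_pmf p q) (\<lambda>z. f (fst z)) \<longleftrightarrow> integrable p f"
    using integrable_map_pmf_eq[of fst "pair_pmf p q" f] by (simp add: map_fst_pair_pmf)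
  show "integrable (pair_pmf p q) (\<lambda>z. g (snd z)) \<longleftrightarrow> integrable q g"
    using integrable_map_pmf_eq[of snd "pair_pmf p q" g] by (simp add: map_snd_pair_pmf)
qed

lemma pmf_square_integrable_imp_integrable:
  fixes f :: "'a \<Rightarrow> real"
  assumes "integrable (measure_pmf q) (\<lambda>x. f x ^ 2)"
  shows "integrable (measure_pmf q) f"
proof (rule Bochner_Integration.integrable_bound)
  show "integrable (measure_pmf q) (\<lambda>x. 1 + f x ^ 2)" using assms by simp
  have "\<bar>t\<bar> \<le> 1 + t ^ 2" for t :: real
    using sum_squares_bound[of "\<bar>t\<bar>" 1] by simp
  then show "AE x in measure_pmf q. norm (f x) \<le> norm (1 + f x ^ 2)"
    by (intro AE_pmfI) (simp add: abs_of_nonneg)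
qed simp

lemma
  fixes f :: "'a \<Rightarrow> real"
  shows integrable_pmf_iff_count_space: "integrable (measure_pmf q) f \<longleftrightarrow> integrable (count_space UNIV) (\<lambda>x. pmf q x * f x)"
    and expectation_eq_count_space: "measure_pmf.expectation q f = (\<integral>x. pmf q x * f x \<partial>count_space UNIV)"
  unfolding measure_pmf_eq_density
  by (subst integrable_density; simp) (subst integral_density; simp)

lemma has_bochner_integral_mono:
  fixes f g :: "'a \<Rightarrow> real"
  assumes "has_bochner_integral M f x" "has_bochner_integral M g y" "\<And>t. f t \<le> g t"
  shows "x \<le> y"
  using assms integral_mono[of M f g] by (simp add: has_bochner_integral_iff)

section \<open>Entropy of a convolution\<close>

lemma ennreal_max_0: "ennreal (max 0 t) = ennreal t"
  by (cases "0 \<le> t") (auto simp: ennreal_neg)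

text \<open>
  The expectation of the positive part of \<open>- ln p - c\<close> (the coercion to extended nonnegative reals
  sends negative numbers to \<open>0\<close>). For \<open>c = 0\<close> it is the entropy; for \<open>c > 0\<close> it measures how much of the
  entropy comes from atoms of mass less than \<open>exp (- c)\<close>.
\<close>
definition entropy_excess :: "'a pmf \<Rightarrow> real \<Rightarrow> ennreal" where
  "entropy_excess p c = (\<integral>\<^sup>+x. ennreal (- ln (pmf p x) - c) \<partial>measure_pmf p)"

lemma neg_ln_pmf_nonneg: "0 \<le> - ln (pmf p x)"
proof (cases "pmf p x = 0")
  case False
  then have "0 < pmf p x" by (simp add: order_less_le)
  then show ?thesis using pmf_le_1[of p x] by simp
qed simp

lemma entropy_excess_finite_iff:
  "entropy_excess p 0 < \<top> \<longleftrightarrow> integrable (measure_pmf p) (\<lambda>x. - ln (pmf p x))"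
proof -
  have "integrable (measure_pmf p) (\<lambda>x. - ln (pmf p x)) \<longleftrightarrow> entropy_excess p 0 < \<top>"
    unfolding integrable_iff_bounded entropy_excess_def
    by (simp add: abs_of_nonpos[OF neg_ln_pmf_nonneg[of p, unfolded neg_0_le_iff_le]])
  then show ?thesis by simp
qed

lemma pmf_entropy_eq:
  assumes "set_pmf p \<subseteq> carrier G"
  shows "pmf_entropy G p = measure_pmf.expectation p (\<lambda>x. - ln (pmf p x))"
  unfolding pmf_entropy_def mult.commute[of "pmf _ _"] infsum_pmf[OF assms] by simp

lemma ennreal_pmf_entropy:
  assumes "set_pmf p \<subseteq> carrier G" "entropy_excess p 0 < \<top>"
  shows "entropy_excess p 0 = ennreal (pmf_entropy G p)"
  unfolding entropy_excess_def pmf_entropy_eq[OF assms(1)]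
  using assms(2) neg_ln_pmf_nonneg[of p] unfolding entropy_excess_finite_iff
  by (subst nn_integral_eq_integral) auto

lemma pmf_entropy_nonneg:
  assumes "set_pmf p \<subseteq> carrier G" shows "0 \<le> pmf_entropy G p"
  unfolding pmf_entropy_eq[OF assms] by (intro Bochner_Integration.integral_nonneg neg_ln_pmf_nonneg)

lemma pmf_conv_ge: "pmf p x * pmf q y \<le> pmf (conv_pmf G p q) (x \<otimes>\<^bsub>G\<^esub> y)"
proof -
  have "pmf p x * pmf q y = measure (pair_pmf p q) {(x, y)}"
    by (simp add: measure_pmf_single pmf_pair)
  also have "\<dots> \<le> measure (pair_pmf p q) ((\<lambda>(x, y). x \<otimes>\<^bsub>G\<^esub> y) -` {x \<otimes>\<^bsub>G\<^esub> y})"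
    by (intro measure_pmf.finite_measure_mono) auto
  finally show ?thesis by (simp add: conv_pmf_def pmf_map)
qed

text \<open>
  The mass of \<open>xy\<close> is at least \<open>p(x) q(y)\<close>, so \<open>- ln\<close> of it is at most \<open>- ln p(x) - ln q(y)\<close>, and positive
  parts are subadditive. Besides the subadditivity of entropy, the truncated version replaces the
  uniform integrability of \<open>- ln p\<^sub>n / n\<close>, which would need products of \<open>n\<close> copies of \<open>\<mu>\<close>.
\<close>
lemma entropy_excess_conv_le:
  "entropy_excess (conv_pmf G p q) (b + c) \<le> entropy_excess p b + entropy_excess q c"
proof -
  have "entropy_excess (conv_pmf G p q) (b + c) =
      (\<integral>\<^sup>+z. ennreal (- ln (pmf (conv_pmf G p q) (fst z \<otimes>\<^bsub>G\<^esub> snd z)) - (b + c)) \<partial>pair_pmf p q)"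
    by (simp add: entropy_excess_def conv_pmf_def case_prod_unfold)
  also have "\<dots> \<le> (\<integral>\<^sup>+z. ennreal (- ln (pmf p (fst z)) - b) + ennreal (- ln (pmf q (snd z)) - c) \<partial>pair_pmf p q)"
  proof (intro nn_integral_mono_AE AE_pmfI)
    fix z assume "z \<in> set_pmf (pair_pmf p q)"
    then have pos: "0 < pmf p (fst z)" "0 < pmf q (snd z)" by (auto simp: pmf_positive_iff)
    have "ln (pmf p (fst z)) + ln (pmf q (snd z)) \<le> ln (pmf (conv_pmf G p q) (fst z \<otimes>\<^bsub>G\<^esub> snd z))"
      using pos pmf_conv_ge[of p "fst z" q "snd z" G]
      by (subst ln_mult_pos[symmetric]) (auto intro: ln_mono)
    then have "ennreal (- ln (pmf (conv_pmf G p q) (fst z \<otimes>\<^bsub>G\<^esub> snd z)) - (b + c))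
        \<le> ennreal ((- ln (pmf p (fst z)) - b) + (- ln (pmf q (snd z)) - c))"
      by (intro ennreal_leI) linarith
    also have "\<dots> \<le> ennreal (max 0 (- ln (pmf p (fst z)) - b) + max 0 (- ln (pmf q (snd z)) - c))"
      by (intro ennreal_leI add_mono max.cobounded2)
    also have "\<dots> = ennreal (max 0 (- ln (pmf p (fst z)) - b)) + ennreal (max 0 (- ln (pmf q (snd z)) - c))"
      by (rule ennreal_plus) simp_all
    finally show "ennreal (- ln (pmf (conv_pmf G p q) (fst z \<otimes>\<^bsub>G\<^esub> snd z)) - (b + c))
        \<le> ennreal (- ln (pmf p (fst z)) - b) + ennreal (- ln (pmf q (snd z)) - c)"
      by (simp add: ennreal_max_0)
  qed
  also have "\<dots> = entropy_excess p b + entropy_excess q c"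
    by (simp add: nn_integral_add nn_integral_pair_pmf' entropy_excess_def)
  finally show ?thesis .
qed

lemma entropy_excess_return [simp]: "entropy_excess (return_pmf x) 0 = 0"
  by (simp add: entropy_excess_def)

lemma entropy_excess_conv_power: "entropy_excess (conv_power G \<mu> n) (real n * c) \<le> of_nat n * entropy_excess \<mu> c"
proof (induction n)
  case (Suc n)
  have "entropy_excess (conv_power G \<mu> (Suc n)) (real (Suc n) * c) =
      entropy_excess (conv_pmf G \<mu> (conv_power G \<mu> n)) (c + real n * c)"
    by (simp add: algebra_simps)
  also have "\<dots> \<le> entropy_excess \<mu> c + entropy_excess (conv_power G \<mu> n) (real n * c)"
    by (rule entropy_excess_conv_le)
  also have "\<dots> \<le> entropy_excess \<mu> c + of_nat n * entropy_excess \<mu> c"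
    by (intro add_left_mono Suc)
  finally show ?case by (simp add: algebra_simps)
qed simp

text \<open>
  On \<open>A\<close>, with \<open>K\<close> elements, \<open>- ln p \<le> ln K + 1 / (K p)\<close>, and the last term has expectation at most \<open>1\<close>
  there. Off \<open>A\<close>, the value \<open>- ln p\<close> is at most \<open>c\<close> plus its excess over \<open>c\<close>.
\<close>
lemma entropy_le_ln_card:
  assumes A: "finite A" "A \<noteq> {}" and c: "0 \<le> c"
  shows "entropy_excess p 0 \<le> ennreal (ln (card A) + 1 + c * measure (measure_pmf p) (- A)) + entropy_excess p c"
proof -
  define K where "K = real (card A)"
  have K: "1 \<le> K" using A by (simp add: K_def Suc_leI card_gt_0_iff)
  let ?f = "\<lambda>x. ennreal (1 / (K * pmf p x)) * indicator A x"
  let ?g = "\<lambda>x. ennreal c * indicator (- A) x"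
  let ?h = "\<lambda>x. ennreal (- ln (pmf p x) - c)"
  have "entropy_excess p 0 \<le> (\<integral>\<^sup>+x. ((?f x + ennreal (ln K)) + ?g x) + ?h x \<partial>p)"
    unfolding entropy_excess_def
  proof (intro nn_integral_mono_AE AE_pmfI)
    fix x assume "x \<in> set_pmf p"
    then have x: "0 < pmf p x" by (simp add: pmf_positive)
    show "ennreal (- ln (pmf p x) - 0) \<le> ((?f x + ennreal (ln K)) + ?g x) + ?h x"
    proof (cases "x \<in> A")
      case True
      have "ln (1 / (K * pmf p x)) \<le> 1 / (K * pmf p x) - 1"
        using x K by (intro ln_le_minus_one) simp
      then have "- ln (pmf p x) \<le> 1 / (K * pmf p x) + ln K"
        using x K by (simp add: ln_div ln_mult)
      then have "ennreal (- ln (pmf p x) - 0) \<le> ennreal (1 / (K * pmf p x) + ln K)"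
        by (intro ennreal_leI) simp
      also have "\<dots> = ennreal (1 / (K * pmf p x)) + ennreal (ln K)"
        using x K by (intro ennreal_plus) auto
      also have "\<dots> \<le> ((?f x + ennreal (ln K)) + ?g x) + ?h x"
        using True by (simp add: add_increasing2)
      finally show ?thesis .
    next
      case False
      have "ennreal (- ln (pmf p x) - 0) \<le> ennreal (c + max 0 (- ln (pmf p x) - c))"
        by (intro ennreal_leI) simp
      also have "\<dots> = ennreal c + ?h x" using c by (simp add: max_def ennreal_neg)
      also have "\<dots> \<le> ((?f x + ennreal (ln K)) + ?g x) + ?h x"
        using False by (auto intro!: add_right_mono add_increasing)
      finally show ?thesis .
    qed
  qed
  also have "\<dots> = (\<integral>\<^sup>+x. ?f x \<partial>p) + ennreal (ln K) + ennreal c * emeasure p (- A) + entropy_excess p c"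
    by (simp add: nn_integral_add nn_integral_cmult entropy_excess_def)
  also have "\<dots> \<le> 1 + ennreal (ln K) + ennreal c * emeasure p (- A) + entropy_excess p c"
  proof (intro add_right_mono)
    have "(\<integral>\<^sup>+x. ?f x \<partial>p) = (\<Sum>x\<in>A. ?f x * pmf p x)"
      using A by (intro nn_integral_measure_pmf_support) auto
    also have "\<dots> \<le> (\<Sum>x\<in>A. ennreal (1 / K))"
    proof (intro sum_mono)
      fix x assume "x \<in> A"
      then have "?f x * pmf p x = ennreal (1 / (K * pmf p x) * pmf p x)"
        using K \<open>x \<in> A\<close> by (subst ennreal_mult) auto
      also have "\<dots> \<le> ennreal (1 / K)" using K by (intro ennreal_leI) auto
      finally show "?f x * pmf p x \<le> ennreal (1 / K)" .
    qed
    also have "\<dots> = ennreal K * ennreal (1 / K)" by (simp add: K_def ennreal_of_nat_eq_real_of_nat)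
    also have "\<dots> = ennreal (K * (1 / K))" using K by (intro ennreal_mult[symmetric]) auto
    also have "\<dots> = 1" using K by simp
    finally show "(\<integral>\<^sup>+x. ?f x \<partial>p) \<le> 1" .
  qed
  also have "\<dots> = ennreal (ln K + 1 + c * measure p (- A)) + entropy_excess p c"
    using K c by (simp add: measure_pmf.emeasure_eq_measure ennreal_mult add.commute)
  finally show ?thesis by (simp add: K_def)
qed

lemma entropy_excess_tendsto_0:
  assumes "entropy_excess p 0 < \<top>"
  shows "(\<lambda>n. entropy_excess p (real n)) \<longlonglongrightarrow> 0"
proof -
  have "(\<lambda>n. \<integral>\<^sup>+x. ennreal (- ln (pmf p x) - real n) \<partial>p) \<longlonglongrightarrow> (\<integral>\<^sup>+x. 0 \<partial>p)"
  proof (rule nn_integral_dominated_convergence[where w="\<lambda>x. ennreal (- ln (pmf p x))"])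
    show "(\<integral>\<^sup>+x. ennreal (- ln (pmf p x)) \<partial>p) < \<infinity>"
      using assms by (simp add: entropy_excess_def)
    show "AE x in p. (\<lambda>n. ennreal (- ln (pmf p x) - real n)) \<longlonglongrightarrow> 0"
    proof (rule AE_I2, rule tendsto_eventually)
      fix x
      show "\<forall>\<^sub>F n in sequentially. ennreal (- ln (pmf p x) - real n) = 0"
        using eventually_ge_at_top[of "nat \<lceil>- ln (pmf p x)\<rceil>"]
        by eventually_elim (simp add: ennreal_neg nat_le_iff ceiling_le_iff)
    qed
  qed (auto intro!: ennreal_leI)
  then show ?thesis by (simp add: entropy_excess_def)
qed

section \<open>Convolution powers on a group\<close>

context group
begin

lemma set_conv_pmf:
  "set_pmf p \<subseteq> carrier G \<Longrightarrow> set_pmf q \<subseteq> carrier G \<Longrightarrow> set_pmf (conv_pmf G p q) \<subseteq> carrier G"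
  by (auto simp: conv_pmf_def)

lemma conv_pmf_assoc:
  assumes "set_pmf p \<subseteq> carrier G" "set_pmf q \<subseteq> carrier G" "set_pmf r \<subseteq> carrier G"
  shows "conv_pmf G (conv_pmf G p q) r = conv_pmf G p (conv_pmf G q r)"
proof -
  have "conv_pmf G (conv_pmf G p q) r = map_pmf (\<lambda>(x, y, z). x \<otimes> y \<otimes> z) (pair_pmf p (pair_pmf q r))"
    by (simp add: conv_pmf_def pair_map_pmf1 map_pmf_comp pair_pair_pmf case_prod_unfold apfst_def map_prod_def)
  also have "\<dots> = map_pmf (\<lambda>(x, y, z). x \<otimes> (y \<otimes> z)) (pair_pmf p (pair_pmf q r))"
    using assms by (intro map_pmf_cong) (auto intro!: m_assoc)
  also have "\<dots> = conv_pmf G p (conv_pmf G q r)"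
    by (simp add: conv_pmf_def pair_map_pmf2 map_pmf_comp case_prod_unfold apsnd_def map_prod_def)
  finally show ?thesis .
qed

lemma conv_pmf_return_one:
  assumes "set_pmf p \<subseteq> carrier G"
  shows "conv_pmf G (return_pmf \<one>) p = p" "conv_pmf G p (return_pmf \<one>) = p"
  using assms by (auto simp: conv_pmf_def pair_return_pmf1 pair_return_pmf2 map_pmf_comp intro!: map_pmf_idI)

lemma set_conv_power: "set_pmf \<mu> \<subseteq> carrier G \<Longrightarrow> set_pmf (conv_power G \<mu> n) \<subseteq> carrier G"
proof (induction n)
  case (Suc n) then show ?case using set_conv_pmf by simp
qed simp

lemma conv_power_add:
  assumes "set_pmf \<mu> \<subseteq> carrier G"
  shows "conv_power G \<mu> (m + n) = conv_pmf G (conv_power G \<mu> m) (conv_power G \<mu> n)"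
  by (induction m) (simp_all add: conv_pmf_return_one conv_pmf_assoc set_conv_power assms)

lemma conv_power_1: "set_pmf \<mu> \<subseteq> carrier G \<Longrightarrow> conv_power G \<mu> 1 = \<mu>"
  by (simp add: conv_pmf_return_one)

lemma inv_conv_pmf:
  assumes "set_pmf p \<subseteq> carrier G" "set_pmf q \<subseteq> carrier G"
  shows "map_pmf (m_inv G) (conv_pmf G p q) = conv_pmf G (map_pmf (m_inv G) q) (map_pmf (m_inv G) p)"
proof -
  have "map_pmf (m_inv G) (conv_pmf G p q) = map_pmf (\<lambda>(x, y). inv y \<otimes> inv x) (pair_pmf p q)"
    unfolding conv_pmf_def map_pmf_comp using assms
    by (intro map_pmf_cong) (auto intro!: inv_mult_group)
  also have "\<dots> = map_pmf (\<lambda>(y, x). inv y \<otimes> inv x) (pair_pmf q p)"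
    by (subst pair_commute_pmf) (simp add: map_pmf_comp case_prod_unfold)
  also have "\<dots> = conv_pmf G (map_pmf (m_inv G) q) (map_pmf (m_inv G) p)"
    by (simp add: conv_pmf_def map_pair[symmetric] map_pmf_comp case_prod_unfold)
  finally show ?thesis .
qed

text \<open>
  Inversion is injective only on the carrier, so the general facts on images under
  injective maps do not apply directly.
\<close>
lemma pmf_map_inv:
  assumes "set_pmf p \<subseteq> carrier G" "x \<in> carrier G"
  shows "pmf (map_pmf (m_inv G) p) x = pmf p (inv x)"
proof -
  have "pmf (map_pmf (m_inv G) p) x = measure p (m_inv G -` {x} \<inter> set_pmf p)"
    by (simp add: pmf_map measure_Int_set_pmf)
  also have "m_inv G -` {x} \<inter> set_pmf p = {inv x} \<inter> set_pmf p" using assms by auto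
  finally show ?thesis by (simp add: measure_Int_set_pmf measure_pmf_single)
qed

lemma symmetric_pmf_iff:
  assumes "set_pmf p \<subseteq> carrier G"
  shows "symmetric_pmf G p \<longleftrightarrow> map_pmf (m_inv G) p = p"
proof
  assume symm: "symmetric_pmf G p"
  show "map_pmf (m_inv G) p = p"
  proof (rule pmf_eqI)
    fix x
    show "pmf (map_pmf (m_inv G) p) x = pmf p x"
    proof (cases "x \<in> carrier G")
      case True
      with symm have "pmf p x = pmf p (inv x)" unfolding symmetric_pmf_def by blast
      then show ?thesis unfolding pmf_map_inv[OF assms True] by (rule sym)
    next
      case False
      then have "x \<notin> set_pmf p" "x \<notin> set_pmf (map_pmf (m_inv G) p)" using assms by auto
      then show ?thesis unfolding set_pmf_iff by simp
    qed
  qed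
next
  assume "map_pmf (m_inv G) p = p"
  then show "symmetric_pmf G p"
    unfolding symmetric_pmf_def using pmf_map_inv[OF assms] by metis
qed

lemma symmetric_conv_power:
  assumes "set_pmf \<mu> \<subseteq> carrier G" "symmetric_pmf G \<mu>"
  shows "symmetric_pmf G (conv_power G \<mu> n)"
proof (induction n)
  case 0
  show ?case using symmetric_pmf_iff[of "return_pmf \<one>"] by simp
next
  case (Suc n)
  have "conv_pmf G (conv_power G \<mu> n) \<mu> = conv_power G \<mu> (Suc n)"
    using conv_power_add[OF assms(1), of n 1] by (simp add: conv_power_1 assms conv_pmf_return_one)
  then show ?case
    using Suc assms set_conv_power[OF assms(1)] by (simp add: symmetric_pmf_iff set_conv_pmf inv_conv_pmf)
qed

lemma pmf_conv_pmf:
  assumes "set_pmf p \<subseteq> carrier G" "set_pmf q \<subseteq> carrier G" "y \<in> carrier G"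
  shows "pmf (conv_pmf G p q) y = measure_pmf.expectation p (\<lambda>x. pmf q (inv x \<otimes> y))"
proof -
  have "conv_pmf G p q = bind_pmf p (\<lambda>x. map_pmf (\<lambda>z. x \<otimes> z) q)"
    unfolding conv_pmf_def pair_pmf_def map_pmf_def bind_assoc_pmf bind_return_pmf by simp
  then have "pmf (conv_pmf G p q) y = measure_pmf.expectation p (\<lambda>x. pmf (map_pmf (\<lambda>z. x \<otimes> z) q) y)"
    by (simp add: pmf_bind)
  also have "\<dots> = measure_pmf.expectation p (\<lambda>x. pmf q (inv x \<otimes> y))"
  proof (intro integral_cong_AE AE_pmfI)
    fix x assume "x \<in> set_pmf p"
    then have x: "x \<in> carrier G" using assms by auto
    have "pmf (map_pmf (\<lambda>z. x \<otimes> z) q) y = measure q ((\<lambda>z. x \<otimes> z) -` {y} \<inter> set_pmf q)"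
      by (simp add: pmf_map measure_Int_set_pmf)
    also have "(\<lambda>z. x \<otimes> z) -` {y} \<inter> set_pmf q = {inv x \<otimes> y} \<inter> set_pmf q"
    proof -
      have "x \<otimes> z = y \<longleftrightarrow> z = inv x \<otimes> y" if "z \<in> set_pmf q" for z
        using that x assms inv_solve_left[of z x y] by auto
      then show ?thesis by auto
    qed
    finally show "pmf (map_pmf (\<lambda>z. x \<otimes> z) q) y = pmf q (inv x \<otimes> y)"
      by (simp add: measure_Int_set_pmf measure_pmf_single)
  qed simp_all
  finally show ?thesis .
qed

end

section \<open>The length of a random walk\<close>

locale metric_random_walk = group G for G (structure) +
  fixes d :: "'a \<Rightarrow> 'a \<Rightarrow> real" and \<mu> :: "'a pmf"
  assumes metric: "Metric_space (carrier G) d"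
    and left_invariant: "left_invariant_dist G d"
    and support: "set_pmf \<mu> \<subseteq> carrier G"
    and symmetric: "symmetric_pmf G \<mu>"
    and second_moment: "finite_second_moment G d \<mu>"
begin

definition len :: "'a \<Rightarrow> real" where "len x = d x \<one>"

abbreviation walk :: "nat \<Rightarrow> 'a pmf" where "walk \<equiv> conv_power G \<mu>"

lemma set_walk: "set_pmf (walk n) \<subseteq> carrier G"
  by (rule set_conv_power[OF support])

lemma set_walkD: "x \<in> set_pmf (walk n) \<Longrightarrow> x \<in> carrier G" "x \<in> set_pmf \<mu> \<Longrightarrow> x \<in> carrier G"
  using set_walk support by blast+

lemma len_nonneg [simp]: "0 \<le> len x"
  using Metric_space.nonneg[OF metric] by (simp add: len_def)

lemma dist_mult_left: "x \<in> carrier G \<Longrightarrow> y \<in> carrier G \<Longrightarrow> d (x \<otimes> y) x = len y"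
  using left_invariant[unfolded left_invariant_dist_def, rule_format, of x y \<one>] by (simp add: len_def)

lemma abs_len_mult_diff_le:
  assumes "x \<in> carrier G" "y \<in> carrier G" shows "\<bar>len (x \<otimes> y) - len x\<bar> \<le> len y"
proof -
  have xy: "x \<otimes> y \<in> carrier G" using assms by simp
  have "len (x \<otimes> y) \<le> len y + len x"
    using Metric_space.triangle[OF metric xy assms(1) one_closed] dist_mult_left[OF assms]
    by (simp add: len_def)
  moreover have "len x \<le> len y + len (x \<otimes> y)"
    using Metric_space.triangle[OF metric assms(1) xy one_closed] dist_mult_left[OF assms]
      Metric_space.commute[OF metric, of x "x \<otimes> y"] by (simp add: len_def)
  ultimately show ?thesis by simp
qed

lemma len_mult_le: "x \<in> carrier G \<Longrightarrow> y \<in> carrier G \<Longrightarrow> len (x \<otimes> y) \<le> len x + len y"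
  using abs_len_mult_diff_le[of x y] by simp

lemma len_one [simp]: "len \<one> = 0"
  using Metric_space.zero[OF metric, of \<one> \<one>] by (simp add: len_def)

lemma len_pos: "x \<in> carrier G \<Longrightarrow> x \<noteq> \<one> \<Longrightarrow> 0 < len x"
  using Metric_space.zero[OF metric, of x \<one>] len_nonneg[of x] by (simp add: len_def)

lemma len_inv: "x \<in> carrier G \<Longrightarrow> len (inv x) = len x"
  using dist_mult_left[of x "inv x"] Metric_space.commute[OF metric, of x \<one>] by (simp add: len_def)

lemma symmetric_walk: "x \<in> carrier G \<Longrightarrow> pmf (walk n) (inv x) = pmf (walk n) x"
  using symmetric_conv_power[OF support symmetric, of n] unfolding symmetric_pmf_def by metis

lemma symmetric_step: "x \<in> carrier G \<Longrightarrow> pmf \<mu> (inv x) = pmf \<mu> x"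
  using symmetric unfolding symmetric_pmf_def by metis

lemma integrable_len_square_step: "integrable \<mu> (\<lambda>x. len x ^ 2)"
  using second_moment summable_on_pmf_iff[OF support, of "\<lambda>x. len x ^ 2"]
  by (simp add: finite_second_moment_def len_def)

lemma M2_eq: "M2 G d \<mu> = sqrt (measure_pmf.expectation \<mu> (\<lambda>x. len x ^ 2))"
  using infsum_pmf[OF support, of "\<lambda>x. len x ^ 2"] by (simp add: M2_def len_def)

lemma integrable_len_square: "integrable (walk n) (\<lambda>x. len x ^ 2)"
proof (induction n)
  case 0 show ?case by (simp add: integrable_measure_pmf_finite)
next
  case (Suc n)
  let ?Q = "pair_pmf \<mu> (walk n)"
  have "integrable ?Q (\<lambda>z. len (fst z \<otimes> snd z) ^ 2)"
  proof (rule Bochner_Integration.integrable_bound)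
    show "integrable ?Q (\<lambda>z. 2 * len (fst z) ^ 2 + 2 * len (snd z) ^ 2)"
      using integrable_pair_pmf_fst[of \<mu> "walk n" "\<lambda>x. len x ^ 2"] integrable_len_square_step
        integrable_pair_pmf_snd[of \<mu> "walk n" "\<lambda>x. len x ^ 2"] Suc by simp
    show "AE z in ?Q. norm (len (fst z \<otimes> snd z) ^ 2) \<le> norm (2 * len (fst z) ^ 2 + 2 * len (snd z) ^ 2)"
    proof (rule AE_pmfI)
      fix z assume "z \<in> set_pmf ?Q"
      then have "len (fst z \<otimes> snd z) \<le> len (fst z) + len (snd z)"
        using set_walkD by (intro len_mult_le) auto
      then have "len (fst z \<otimes> snd z) ^ 2 \<le> (len (fst z) + len (snd z)) ^ 2"
        by (intro power_mono) auto
      also have "\<dots> \<le> 2 * len (fst z) ^ 2 + 2 * len (snd z) ^ 2"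
        using sum_squares_bound[of "len (fst z)" "len (snd z)"] by (simp add: power2_sum)
      finally show "norm (len (fst z \<otimes> snd z) ^ 2) \<le> norm (2 * len (fst z) ^ 2 + 2 * len (snd z) ^ 2)"
        by simp
    qed
  qed simp
  then show ?case by (simp add: conv_pmf_def case_prod_unfold)
qed

lemma integrable_len: "integrable (walk n) len"
  using integrable_len_square by (rule pmf_square_integrable_imp_integrable)

definition mean_len :: "nat \<Rightarrow> real" where
  "mean_len n = measure_pmf.expectation (walk n) len"

lemma mean_len_subadditive: "mean_len (m + n) \<le> mean_len m + mean_len n"
proof -
  let ?Q = "pair_pmf (walk m) (walk n)"
  have int: "integrable ?Q (\<lambda>z. len (fst z))" "integrable ?Q (\<lambda>z. len (snd z))"
    by (simp_all add: integrable_pair_pmf_fst integrable_pair_pmf_snd integrable_len)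
  have eq: "walk (m + n) = map_pmf (\<lambda>z. fst z \<otimes> snd z) ?Q"
    by (simp add: conv_power_add[OF support] conv_pmf_def case_prod_unfold)
  have "mean_len (m + n) = measure_pmf.expectation ?Q (\<lambda>z. len (fst z \<otimes> snd z))"
    unfolding mean_len_def eq by simp
  also have "\<dots> \<le> measure_pmf.expectation ?Q (\<lambda>z. len (fst z) + len (snd z))"
  proof (intro integral_mono_AE AE_pmfI)
    show "integrable ?Q (\<lambda>z. len (fst z \<otimes> snd z))"
      using integrable_len[of "m + n"] unfolding eq by simp
    show "len (fst z \<otimes> snd z) \<le> len (fst z) + len (snd z)" if "z \<in> set_pmf ?Q" for z
      using that set_walkD by (intro len_mult_le) auto
  qed (use int in simp)
  also have "\<dots> = measure_pmf.expectation (map_pmf fst ?Q) len + measure_pmf.expectation (map_pmf snd ?Q) len"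
    using int by simp
  finally show ?thesis by (simp add: map_fst_pair_pmf map_snd_pair_pmf mean_len_def)
qed

lemma mean_len_nonneg: "0 \<le> mean_len n"
  by (simp add: mean_len_def)

lemma drift_limit:
  shows tendsto_drift: "(\<lambda>n. mean_len n / real n) \<longlonglongrightarrow> drift G d \<mu>"
    and drift_le: "n > 0 \<Longrightarrow> drift G d \<mu> \<le> mean_len n / real n"
proof -
  obtain L where L: "(\<lambda>n. mean_len n / real n) \<longlonglongrightarrow> L" "\<And>n. n > 0 \<Longrightarrow> L \<le> mean_len n / real n"
    using fekete[of mean_len] mean_len_subadditive mean_len_nonneg by blast
  have "drift G d \<mu> = lim (\<lambda>n. mean_len n / real n)"
    using infsum_pmf[OF set_walk, of len] by (simp add: drift_def mean_len_def len_def)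
  then have "drift G d \<mu> = L" using limI[OF L(1)] by simp
  then show "(\<lambda>n. mean_len n / real n) \<longlonglongrightarrow> drift G d \<mu>" "n > 0 \<Longrightarrow> drift G d \<mu> \<le> mean_len n / real n"
    using L by auto
qed

end

section \<open>The entropy of a random walk\<close>

locale finite_entropy_walk = metric_random_walk +
  assumes entropy: "finite_entropy G \<mu>"
begin

lemma entropy_excess_step_finite: "entropy_excess \<mu> 0 < \<top>"
  using entropy summable_on_pmf_iff[OF support, of "\<lambda>x. - ln (pmf \<mu> x)"]
  unfolding entropy_excess_finite_iff by (simp add: finite_entropy_def mult.commute)

lemma entropy_excess_walk_finite: "entropy_excess (walk n) 0 < \<top>"
proof -
  have "entropy_excess (walk n) 0 \<le> of_nat n * entropy_excess \<mu> 0"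
    using entropy_excess_conv_power[of G \<mu> n 0] by simp
  also have "\<dots> < \<top>"
    using entropy_excess_step_finite by (simp add: ennreal_mult_less_top of_nat_less_top)
  finally show ?thesis .
qed

definition walk_entropy :: "nat \<Rightarrow> real" where
  "walk_entropy n = pmf_entropy G (walk n)"

lemma walk_entropy_nonneg: "0 \<le> walk_entropy n"
  unfolding walk_entropy_def by (rule pmf_entropy_nonneg[OF set_walk])

lemma ennreal_walk_entropy: "entropy_excess (walk n) 0 = ennreal (walk_entropy n)"
  unfolding walk_entropy_def by (rule ennreal_pmf_entropy[OF set_walk entropy_excess_walk_finite])

lemma walk_entropy_subadditive: "walk_entropy (m + n) \<le> walk_entropy m + walk_entropy n"
proof -
  have "ennreal (walk_entropy (m + n)) \<le> ennreal (walk_entropy m) + ennreal (walk_entropy n)"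
    using entropy_excess_conv_le[of G "walk m" "walk n" 0 0]
    by (simp add: ennreal_walk_entropy[symmetric] conv_power_add[OF support])
  then show ?thesis
    using walk_entropy_nonneg by (simp add: ennreal_plus[symmetric] del: ennreal_plus)
qed

lemma entropy_limit:
  shows tendsto_asymptotic_entropy: "(\<lambda>n. walk_entropy n / real n) \<longlonglongrightarrow> asymptotic_entropy G \<mu>"
    and asymptotic_entropy_le: "n > 0 \<Longrightarrow> asymptotic_entropy G \<mu> \<le> walk_entropy n / real n"
proof -
  obtain L where L: "(\<lambda>n. walk_entropy n / real n) \<longlonglongrightarrow> L" "\<And>n. n > 0 \<Longrightarrow> L \<le> walk_entropy n / real n"
    using fekete[of walk_entropy] walk_entropy_subadditive walk_entropy_nonneg by blast
  have "asymptotic_entropy G \<mu> = L"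
    using limI[OF L(1)] by (simp add: asymptotic_entropy_def walk_entropy_def)
  then show "(\<lambda>n. walk_entropy n / real n) \<longlonglongrightarrow> asymptotic_entropy G \<mu>"
      "n > 0 \<Longrightarrow> asymptotic_entropy G \<mu> \<le> walk_entropy n / real n"
    using L by auto
qed

end

section \<open>Entropy is at most drift times growth\<close>

context metric_random_walk
begin

text \<open>
  A one-sided weak law of large numbers. Decompose the walk at time \<open>k m\<close> into \<open>k\<close> independent blocks of
  length \<open>m\<close>. If \<open>a\<close> is the positive part of the deviation after \<open>k\<close> blocks and \<open>b\<close> the centred length
  of the next block, the positive part of the new deviation is at most \<open>\<bar>a + b\<bar>\<close>; as \<open>b\<close> has
  mean \<open>0\<close> and is independent of \<open>a\<close>, the mean of \<open>(a + b)\<^sup>2\<close> is the mean of \<open>a\<^sup>2\<close> plus the variance \<open>V\<close>.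
\<close>
lemma second_moment_above_mean:
  fixes m :: nat
  defines "\<alpha> \<equiv> mean_len m" and "V \<equiv> measure_pmf.expectation (walk m) (\<lambda>x. (len x - mean_len m) ^ 2)"
  shows "(\<integral>\<^sup>+x. ennreal (max 0 (len x - real k * \<alpha>) ^ 2) \<partial>walk (k * m)) \<le> ennreal (real k * V)"
proof (induction k)
  case (Suc k)
  have V: "0 \<le> V" by (simp add: V_def)
  have int: "integrable (walk m) (\<lambda>x. (len x - \<alpha>) ^ 2)"
    using integrable_len_square[of m] integrable_len[of m] by (simp add: power2_diff)
  have "(\<integral>\<^sup>+x. ennreal (max 0 (len x - real (Suc k) * \<alpha>) ^ 2) \<partial>walk (Suc k * m))
      = (\<integral>\<^sup>+x. \<integral>\<^sup>+y. ennreal (max 0 (len (x \<otimes> y) - real (Suc k) * \<alpha>) ^ 2) \<partial>walk m \<partial>walk (k * m))"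
    using conv_power_add[OF support, of "k * m" m]
    by (simp add: conv_pmf_def nn_integral_pair_pmf' add.commute)
  also have "\<dots> \<le> (\<integral>\<^sup>+x. \<integral>\<^sup>+y. ennreal ((max 0 (len x - real k * \<alpha>) + (len y - \<alpha>)) ^ 2) \<partial>walk m \<partial>walk (k * m))"
  proof (intro nn_integral_mono_AE AE_pmfI ennreal_leI)
    fix x y assume "x \<in> set_pmf (walk (k * m))" "y \<in> set_pmf (walk m)"
    then have "len (x \<otimes> y) \<le> len x + len y" using set_walkD by (intro len_mult_le) auto
    then have "max 0 (len (x \<otimes> y) - real (Suc k) * \<alpha>) \<le> max 0 (max 0 (len x - real k * \<alpha>) + (len y - \<alpha>))"
      by (simp add: algebra_simps)
    then have "max 0 (len (x \<otimes> y) - real (Suc k) * \<alpha>) ^ 2 \<le> max 0 (max 0 (len x - real k * \<alpha>) + (len y - \<alpha>)) ^ 2"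
      by (intro power_mono) auto
    also have "\<dots> \<le> (max 0 (len x - real k * \<alpha>) + (len y - \<alpha>)) ^ 2"
      by (simp add: max_def)
    finally show "max 0 (len (x \<otimes> y) - real (Suc k) * \<alpha>) ^ 2 \<le> (max 0 (len x - real k * \<alpha>) + (len y - \<alpha>)) ^ 2" .
  qed
  also have "\<dots> = (\<integral>\<^sup>+x. ennreal (max 0 (len x - real k * \<alpha>) ^ 2) + ennreal V \<partial>walk (k * m))"
  proof (rule nn_integral_cong)
    fix x
    define a where "a = max 0 (len x - real k * \<alpha>)"
    have int': "integrable (walk m) (\<lambda>y. a ^ 2 + 2 * a * (len y - \<alpha>) + (len y - \<alpha>) ^ 2)"
      using int integrable_len[of m] by simp
    have "(\<integral>\<^sup>+y. ennreal ((a + (len y - \<alpha>)) ^ 2) \<partial>walk m)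
        = (\<integral>\<^sup>+y. ennreal (a ^ 2 + 2 * a * (len y - \<alpha>) + (len y - \<alpha>) ^ 2) \<partial>walk m)"
      by (simp add: power2_sum add_ac)
    also have "\<dots> = ennreal (measure_pmf.expectation (walk m) (\<lambda>y. a ^ 2 + 2 * a * (len y - \<alpha>) + (len y - \<alpha>) ^ 2))"
    proof (rule nn_integral_eq_integral[OF int'])
      have "0 \<le> a ^ 2 + 2 * a * (len y - \<alpha>) + (len y - \<alpha>) ^ 2" for y
        using zero_le_power2[of "a + (len y - \<alpha>)"] unfolding power2_sum[of a] by simp
      then show "AE y in walk m. 0 \<le> a ^ 2 + 2 * a * (len y - \<alpha>) + (len y - \<alpha>) ^ 2" by simp
    qed
    also have "measure_pmf.expectation (walk m) (\<lambda>y. a ^ 2 + 2 * a * (len y - \<alpha>) + (len y - \<alpha>) ^ 2) = a ^ 2 + V"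
      using int integrable_len[of m] by (simp add: V_def \<alpha>_def mean_len_def)
    finally show "(\<integral>\<^sup>+y. ennreal ((max 0 (len x - real k * \<alpha>) + (len y - \<alpha>)) ^ 2) \<partial>walk m)
        = ennreal (max 0 (len x - real k * \<alpha>) ^ 2) + ennreal V"
      using V by (simp add: a_def)
  qed
  also have "\<dots> = (\<integral>\<^sup>+x. ennreal (max 0 (len x - real k * \<alpha>) ^ 2) \<partial>walk (k * m)) + ennreal V"
    by (simp add: nn_integral_add)
  also have "\<dots> \<le> ennreal (real k * V) + ennreal V" by (intro add_right_mono Suc)
  also have "\<dots> = ennreal (real (Suc k) * V)"
    using V by (simp add: ennreal_plus[symmetric] algebra_simps del: ennreal_plus)
  finally show ?case .
qed simp

text \<open>
  Chebyshev's inequality. The bound decays like \<open>1 / k\<close>.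
\<close>
lemma prob_far_le:
  fixes m :: nat
  assumes k: "0 < k" and \<eta>: "0 < \<eta>"
  shows "measure_pmf.prob (walk (k * m)) {x. real k * (mean_len m + \<eta>) < len x}
    \<le> measure_pmf.expectation (walk m) (\<lambda>x. (len x - mean_len m) ^ 2) / (real k * \<eta> ^ 2)"
proof -
  let ?V = "measure_pmf.expectation (walk m) (\<lambda>x. (len x - mean_len m) ^ 2)"
  let ?A = "{x. real k * (mean_len m + \<eta>) < len x}"
  have "ennreal ((real k * \<eta>) ^ 2 * measure_pmf.prob (walk (k * m)) ?A) = (\<integral>\<^sup>+x. ennreal ((real k * \<eta>) ^ 2) * indicator ?A x \<partial>walk (k * m))"
    by (simp add: nn_integral_cmult measure_pmf.emeasure_eq_measure ennreal_mult)
  also have "\<dots> \<le> (\<integral>\<^sup>+x. ennreal (max 0 (len x - real k * mean_len m) ^ 2) \<partial>walk (k * m))"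
  proof (intro nn_integral_mono)
    fix x
    show "ennreal ((real k * \<eta>) ^ 2) * indicator ?A x \<le> ennreal (max 0 (len x - real k * mean_len m) ^ 2)"
    proof (cases "x \<in> ?A")
      case True
      then have "real k * \<eta> \<le> max 0 (len x - real k * mean_len m)" by (simp add: algebra_simps)
      then have "(real k * \<eta>) ^ 2 \<le> max 0 (len x - real k * mean_len m) ^ 2"
        using \<eta> by (intro power_mono) auto
      then show ?thesis using True by (simp add: ennreal_leI)
    qed simp
  qed
  also have "\<dots> \<le> ennreal (real k * ?V)" by (rule second_moment_above_mean)
  finally have "(real k * \<eta>) ^ 2 * measure_pmf.prob (walk (k * m)) ?A \<le> real k * ?V"
    by (simp add: ennreal_le_iff)
  then show ?thesis using k \<eta> by (simp add: field_simps power2_eq_square)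
qed

definition ball :: "real \<Rightarrow> 'a set" where "ball r = {x \<in> carrier G. len x \<le> r}"

lemma ball_eq: "ball r = Metric_space.mcball (carrier G) d \<one> r"
  using Metric_space.mcball_def[OF metric] Metric_space.commute[OF metric]
  by (auto simp: ball_def len_def)

lemma one_in_ball: "0 \<le> r \<Longrightarrow> \<one> \<in> ball r"
  by (simp add: ball_def)

lemma ball_mono: "r \<le> s \<Longrightarrow> ball r \<subseteq> ball s"
  by (auto simp: ball_def)

end

locale growth_walk = metric_random_walk +
  fixes v :: real
  assumes proper: "proper_dist G d" and growth: "growth G d = ereal v"
begin

lemma finite_ball: "finite (ball r)"
  using proper by (simp add: proper_dist_def ball_eq)

lemma card_ball_pos: "0 \<le> r \<Longrightarrow> 0 < card (ball r)"
  using finite_ball one_in_ball by (auto simp: card_gt_0_iff)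

lemma growth_liminf: "liminf (\<lambda>n. ereal (ln (real (card (ball (real n)))) / real n)) = ereal v"
  using growth by (simp add: growth_def ball_eq)

lemma growth_nonneg: "0 \<le> v"
proof -
  have "ereal 0 \<le> liminf (\<lambda>n. ereal (ln (real (card (ball (real n)))) / real n))"
  proof (rule Liminf_bounded, rule always_eventually, rule allI)
    fix n
    have "1 \<le> real (card (ball (real n)))" using card_ball_pos[of "real n"] by linarith
    then show "ereal 0 \<le> ereal (ln (real (card (ball (real n)))) / real n)" by simp
  qed
  then show ?thesis by (simp add: growth_liminf)
qed

text \<open>
  The growth is a lower limit, so ball sizes are controlled along some sequence of radii only.
\<close>
lemma frequently_small_ball:
  assumes "v < b"
  shows "\<exists>n\<ge>N. ln (real (card (ball (real n)))) \<le> b * real n"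
proof (rule ccontr)
  assume small: "\<not> ?thesis"
  have "\<forall>\<^sub>F n in sequentially. ereal b \<le> ereal (ln (real (card (ball (real n)))) / real n)"
    using eventually_ge_at_top[of "Suc N"]
  proof eventually_elim
    case (elim n)
    then have "b * real n \<le> ln (real (card (ball (real n))))"
      using small by (metis Suc_leD linear)
    then show ?case using elim by (simp add: pos_le_divide_eq)
  qed
  then have "ereal b \<le> ereal v" unfolding growth_liminf[symmetric] by (rule Liminf_bounded)
  then show False using assms by simp
qed

end

locale entropy_growth_walk = finite_entropy_walk + growth_walk
begin

lemma drift_nonneg: "0 \<le> drift G d \<mu>"
  using tendsto_drift mean_len_nonneg by (intro LIMSEQ_le_const) auto

text \<open>
  Choose a block length \<open>m\<close> whose mean length is within \<open>m \<epsilon>\<close> of \<open>m \<ell>\<close>. After \<open>k\<close> blocks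
  the walk is in the ball of radius \<open>k \<tau>\<close>, where \<open>\<tau> \<le> m (\<ell> + 2 \<epsilon>)\<close>, except with probability \<open>O(1 / k)\<close>;
  the exceptional part then contributes a constant and a multiple \<open>\<epsilon>\<close> of the time to the entropy.
  The number \<open>k\<close> is adapted to a radius at which the ball is small.
\<close>
lemma asymptotic_entropy_le_approx:
  assumes \<epsilon>: "0 < \<epsilon>"
  shows "asymptotic_entropy G \<mu> \<le> (v + \<epsilon>) * (drift G d \<mu> + 2 * \<epsilon>) + \<epsilon>"
proof -
  define l where "l = drift G d \<mu>"
  define h where "h = asymptotic_entropy G \<mu>"
  have l0: "0 \<le> l" by (simp add: l_def drift_nonneg)
  have "\<forall>\<^sub>F n in sequentially. mean_len n / real n < l + \<epsilon>"
    using tendsto_drift \<epsilon> unfolding l_def by (intro order_tendstoD) auto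
  then have "\<forall>\<^sub>F n in sequentially. 0 < n \<and> mean_len n / real n < l + \<epsilon>"
    using eventually_gt_at_top[of 0] by eventually_elim auto
  then obtain m where m: "0 < m" "mean_len m / real m < l + \<epsilon>"
    using eventually_happens' sequentially_bot by blast
  define \<eta> where "\<eta> = real m * \<epsilon>"
  define \<tau> where "\<tau> = mean_len m + \<eta>"
  have \<eta>: "0 < \<eta>" using m \<epsilon> by (simp add: \<eta>_def)
  have \<tau>: "0 < \<tau>" "\<tau> \<le> real m * (l + 2 * \<epsilon>)"
    using \<eta> m mean_len_nonneg[of m] by (auto simp: \<tau>_def \<eta>_def field_simps)
  define V where "V = measure_pmf.expectation (walk m) (\<lambda>x. (len x - mean_len m) ^ 2)"
  have "\<forall>\<^sub>F n in sequentially. entropy_excess \<mu> (real n) < ennreal \<epsilon>"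
    using entropy_excess_tendsto_0[OF entropy_excess_step_finite] \<epsilon> by (intro order_tendstoD) auto
  then obtain c where c: "entropy_excess \<mu> (real c) < ennreal \<epsilon>"
    using eventually_happens' sequentially_bot by blast
  \<comment> \<open>At level \<open>c\<close> per step, leaving the ball costs \<open>k m c\<close> times a probability of at most \<open>V / (k \<eta>\<^sup>2)\<close>; the factor \<open>k\<close> cancels.\<close>
  define C where "C = 1 + real m * real c * (V / \<eta> ^ 2)"
  have key: "real k * real m * h \<le> ln (real (card (ball (real k * \<tau>)))) + C + real k * real m * \<epsilon>" if k: "0 < k" for k
  proof -
    let ?A = "ball (real k * \<tau>)"
    have A: "0 < card ?A" using card_ball_pos \<tau> by simp
    have ln0: "0 \<le> ln (real (card ?A))" using A by (simp add: Suc_leI)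
    have "ennreal (walk_entropy (k * m)) \<le> ennreal (ln (real (card ?A)) + 1 + real (k * m) * c * measure_pmf.prob (walk (k * m)) (- ?A))
        + entropy_excess (walk (k * m)) (real (k * m) * c)"
      unfolding ennreal_walk_entropy[symmetric]
      using A by (intro entropy_le_ln_card) (auto simp: card_gt_0_iff)
    also have "\<dots> \<le> ennreal (ln (real (card ?A)) + C) + ennreal (real (k * m) * \<epsilon>)"
    proof (rule add_mono)
      have "measure_pmf.prob (walk (k * m)) (- ?A) = measure_pmf.prob (walk (k * m)) (- ?A \<inter> set_pmf (walk (k * m)))"
        by (simp add: measure_Int_set_pmf)
      also have "\<dots> \<le> measure_pmf.prob (walk (k * m)) {x. real k * (mean_len m + \<eta>) < len x}"
        using set_walkD by (intro measure_pmf.finite_measure_mono) (auto simp: ball_def \<tau>_def)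
      also have "\<dots> \<le> V / (real k * \<eta> ^ 2)" unfolding V_def by (rule prob_far_le[OF k \<eta>])
      finally have "real (k * m) * c * measure_pmf.prob (walk (k * m)) (- ?A) \<le> real (k * m) * c * (V / (real k * \<eta> ^ 2))"
        by (intro mult_left_mono) auto
      also have "\<dots> = real m * real c * (V / \<eta> ^ 2)" using k by simp
      finally show "ennreal (ln (real (card ?A)) + 1 + real (k * m) * c * measure_pmf.prob (walk (k * m)) (- ?A))
          \<le> ennreal (ln (real (card ?A)) + C)"
        by (intro ennreal_leI) (simp add: C_def)
      have "entropy_excess (walk (k * m)) (real (k * m) * c) \<le> of_nat (k * m) * entropy_excess \<mu> c"
        by (rule entropy_excess_conv_power)
      also have "\<dots> \<le> of_nat (k * m) * ennreal \<epsilon>" using c by (intro mult_left_mono) auto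
      also have "\<dots> = ennreal (real (k * m) * \<epsilon>)"
        using \<epsilon> by (simp only: ennreal_of_nat_eq_real_of_nat) (simp add: ennreal_mult)
      finally show "entropy_excess (walk (k * m)) (real (k * m) * c) \<le> ennreal (real (k * m) * \<epsilon>)" .
    qed
    also have "\<dots> = ennreal (ln (real (card ?A)) + C + real (k * m) * \<epsilon>)"
      using \<epsilon> ln0 by (intro ennreal_plus[symmetric]) (auto simp: C_def V_def intro!: add_nonneg_nonneg)
    finally have "walk_entropy (k * m) \<le> ln (real (card ?A)) + C + real (k * m) * \<epsilon>"
      using \<epsilon> ln0 by (subst (asm) ennreal_le_iff) (auto simp: C_def V_def intro!: add_nonneg_nonneg)
    moreover have "h \<le> walk_entropy (k * m) / real (k * m)"
      unfolding h_def using k m by (intro asymptotic_entropy_le) simp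
    then have "real k * real m * h \<le> walk_entropy (k * m)" using k m by (simp add: field_simps)
    ultimately show ?thesis by simp
  qed
  define b where "b = (v + \<epsilon>) * (l + 2 * \<epsilon>)"
  have freq: "\<exists>k\<ge>k0. 0 < k \<and> real k * (real m * (h - b - \<epsilon>)) \<le> C + real m * b" for k0
  proof -
    define n0 where "n0 = nat \<lceil>real (Suc k0) * \<tau>\<rceil>"
    have "\<exists>n\<ge>n0. ln (real (card (ball (real n)))) \<le> (v + \<epsilon>) * real n"
      by (rule frequently_small_ball) (use \<epsilon> in simp)
    then obtain N where N: "n0 \<le> N" "ln (real (card (ball (real N)))) \<le> (v + \<epsilon>) * real N" by blast
    define k where "k = nat \<lfloor>real N / \<tau>\<rfloor>"
    have N\<tau>: "0 \<le> real N / \<tau>" using \<tau> by simp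
    have "real (Suc k0) * \<tau> \<le> real N" using N(1) unfolding n0_def by linarith
    then have "real (Suc k0) \<le> real N / \<tau>" using \<tau> by (simp add: field_simps)
    then have k: "Suc k0 \<le> k" by (simp add: k_def le_nat_iff le_floor_iff)
    have "real k \<le> real N / \<tau>" "real N / \<tau> \<le> real k + 1"
      using N\<tau> by (auto simp: k_def)
    then have k1: "real k * \<tau> \<le> real N" and k2: "real N \<le> (real k + 1) * \<tau>"
      using \<tau> by (auto simp: field_simps)
    have "card (ball (real k * \<tau>)) \<le> card (ball (real N))"
      using k1 finite_ball by (intro card_mono ball_mono)
    then have "ln (real (card (ball (real k * \<tau>)))) \<le> ln (real (card (ball (real N))))"
      using card_ball_pos[of "real k * \<tau>"] \<tau> by simp
    also have "\<dots> \<le> (v + \<epsilon>) * ((real k + 1) * (real m * (l + 2 * \<epsilon>)))"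
    proof -
      have "real N \<le> (real k + 1) * (real m * (l + 2 * \<epsilon>))"
        by (rule order_trans[OF k2]) (use \<tau> in \<open>simp add: mult_left_mono\<close>)
      then have "(v + \<epsilon>) * real N \<le> (v + \<epsilon>) * ((real k + 1) * (real m * (l + 2 * \<epsilon>)))"
        using growth_nonneg \<epsilon> by (intro mult_left_mono) auto
      then show ?thesis using N(2) by linarith
    qed
    also have "\<dots> = (real k + 1) * (real m * b)" by (simp add: b_def algebra_simps)
    finally have "real k * real m * h \<le> (real k + 1) * (real m * b) + C + real k * real m * \<epsilon>"
      using key[of k] k by simp
    then show ?thesis using k by (intro exI[of _ k]) (auto simp: algebra_simps)
  qed
  \<comment> \<open>A bounded quantity is at least a positive multiple of arbitrarily large \<open>k\<close>.\<close>
  have "h - b - \<epsilon> \<le> 0"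
  proof (rule ccontr)
    assume "\<not> ?thesis"
    then have "0 < real m * (h - b - \<epsilon>)" using m by simp
    then obtain k0 where k0: "C + real m * b < real k0 * (real m * (h - b - \<epsilon>))"
      using reals_Archimedean3 by blast
    obtain k where k: "k \<ge> k0" "real k * (real m * (h - b - \<epsilon>)) \<le> C + real m * b" using freq by blast
    have "real k0 * (real m * (h - b - \<epsilon>)) \<le> real k * (real m * (h - b - \<epsilon>))"
      using k \<open>0 < real m * (h - b - \<epsilon>)\<close> by (intro mult_right_mono) auto
    then show False using k k0 by linarith
  qed
  then show ?thesis by (simp add: h_def b_def l_def)
qed

lemma asymptotic_entropy_le_drift_growth: "asymptotic_entropy G \<mu> \<le> v * drift G d \<mu>"
proof -
  let ?f = "\<lambda>\<epsilon>. (v + \<epsilon>) * (drift G d \<mu> + 2 * \<epsilon>) + \<epsilon>"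
  have "(?f \<longlongrightarrow> (v + 0) * (drift G d \<mu> + 2 * 0) + 0) (at_right 0)"
    by (intro tendsto_intros)
  moreover have "\<forall>\<^sub>F \<epsilon> in at_right 0. asymptotic_entropy G \<mu> \<le> ?f \<epsilon>"
    using asymptotic_entropy_le_approx by (auto simp: eventually_at_right_field intro: exI[of _ 1])
  ultimately have "asymptotic_entropy G \<mu> \<le> (v + 0) * (drift G d \<mu> + 2 * 0) + 0"
    by (intro tendsto_lowerbound) auto
  then show ?thesis by simp
qed

end

section \<open>Entropy production of the Green measure\<close>

context metric_random_walk
begin

text \<open>
  A pair \<open>(x, g)\<close> stands for the oriented edge from \<open>x\<close> to \<open>xg\<close>, and this is the change of orientation.
  It is the identity off the carrier, which makes it a bijection of the whole type.
\<close>
definition reverse :: "'a \<times> 'a \<Rightarrow> 'a \<times> 'a" where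
  "reverse e = (if e \<in> carrier G \<times> carrier G then (fst e \<otimes> snd e, inv (snd e)) else e)"

lemma reverse_reverse: "reverse (reverse e) = e"
  by (auto simp: reverse_def m_assoc)

lemma bij_reverse: "bij_betw reverse UNIV UNIV"
  by (rule bij_betw_byWitness[where f'=reverse]) (auto simp: reverse_reverse)

text \<open>
  If \<open>w\<close> is the weight of the edges, reversal is a bijection, so \<open>f\<close> has the same sum against \<open>w\<close> as \<open>f \<circ> reverse\<close> against
  \<open>w \<circ> reverse\<close>. For functions that are even (\<open>\<sigma> = 1\<close>) or odd (\<open>\<sigma> = -1\<close>) under reversal, the expectation
  is thus half the sum against \<open>w + \<sigma> (w \<circ> reverse)\<close>.
\<close>
lemma has_integral_symmetrised:
  fixes f :: "'a \<times> 'a \<Rightarrow> real" and \<sigma> :: real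
  assumes \<nu>: "set_pmf \<nu> \<subseteq> carrier G"
    and int: "integrable (pair_pmf \<nu> \<mu>) f"
    and eigen: "\<And>x g. x \<in> carrier G \<Longrightarrow> g \<in> carrier G \<Longrightarrow> f (x \<otimes> g, inv g) = \<sigma> * f (x, g)"
  shows "has_bochner_integral (count_space UNIV)
      (\<lambda>e. (pmf (pair_pmf \<nu> \<mu>) e + \<sigma> * pmf (pair_pmf \<nu> \<mu>) (reverse e)) * f e)
      (2 * measure_pmf.expectation (pair_pmf \<nu> \<mu>) f)"
proof -
  let ?w = "pmf (pair_pmf \<nu> \<mu>)"
  let ?I = "measure_pmf.expectation (pair_pmf \<nu> \<mu>) f"
  have zero: "?w e = 0" if "e \<notin> carrier G \<times> carrier G" for e
    using that \<nu> support by (cases e) (auto simp: pmf_pair set_pmf_iff)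
  have eigen': "?w (reverse e) * f (reverse e) = \<sigma> * (?w (reverse e) * f e)" for e
  proof (cases "e \<in> carrier G \<times> carrier G")
    case True
    then have "fst e \<in> carrier G" "snd e \<in> carrier G" by auto
    then show ?thesis using eigen[of "fst e" "snd e"] by (simp add: reverse_def mem_Times_iff)
  next
    case False
    then show ?thesis using zero[OF False] by (simp add: reverse_def)
  qed
  have 1: "has_bochner_integral (count_space UNIV) (\<lambda>e. ?w e * f e) ?I"
    using int unfolding integrable_pmf_iff_count_space expectation_eq_count_space
    by (rule has_bochner_integral_integrable)
  then have "has_bochner_integral (count_space UNIV) (\<lambda>e. ?w (reverse e) * f (reverse e)) ?I"
    using integrable_bij_count_space[OF bij_reverse, of "\<lambda>e. ?w e * f e"]
      integral_bij_count_space[OF bij_reverse, of "\<lambda>e. ?w e * f e"]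
    by (simp add: has_bochner_integral_iff)
  then have "has_bochner_integral (count_space UNIV) (\<lambda>e. \<sigma> * (?w (reverse e) * f e)) ?I"
    by (simp only: eigen')
  then have "has_bochner_integral (count_space UNIV) (\<lambda>e. ?w e * f e + \<sigma> * (?w (reverse e) * f e)) (?I + ?I)"
    by (rule has_bochner_integral_add[OF 1])
  then show ?thesis by (simp add: algebra_simps)
qed

text \<open>
  The left-hand side is the tangent of \<open>F t = t ln ((1 + t) / (1 - t))\<close> at \<open>t = tanh z\<close>, evaluated
  at the mean length increment divided by \<open>m2\<close>. The increments of \<open>- ln \<nu>\<close> and of the length are
  odd under reversal, the constant \<open>1\<close> and \<open>\<bar>g\<bar>\<^sup>2\<close> are even. After symmetrisation, the claim is the
  sum over all edges of \<open>ln_difference_tangent\<close>. The closure assumption on the support, with the symmetry of \<open>\<mu>\<close>,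
  ensures that an edge has either two end points of positive mass or none.
\<close>
lemma entropy_production_ge:
  fixes \<nu> :: "'a pmf" and z :: real
  defines "Q \<equiv> pair_pmf \<nu> \<mu>" and "m2 \<equiv> M2 G d \<mu>"
  assumes \<nu>: "set_pmf \<nu> \<subseteq> carrier G"
    and closed: "\<And>x g. x \<in> set_pmf \<nu> \<Longrightarrow> g \<in> set_pmf \<mu> \<Longrightarrow> x \<otimes> g \<in> set_pmf \<nu>"
    and ent: "integrable Q (\<lambda>e. ln (pmf \<nu> (fst e)) - ln (pmf \<nu> (fst e \<otimes> snd e)))"
    and len: "integrable Q (\<lambda>e. len (fst e \<otimes> snd e) - len (fst e))"
    and m2: "0 < m2" and z: "0 < z"
  shows "2 * z * tanh z + 4 * entropy_slope z * tanh z *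
      (measure_pmf.expectation Q (\<lambda>e. len (fst e \<otimes> snd e) - len (fst e)) / m2 - tanh z)
    \<le> measure_pmf.expectation Q (\<lambda>e. ln (pmf \<nu> (fst e)) - ln (pmf \<nu> (fst e \<otimes> snd e)))"
proof -
  let ?w = "pmf Q"
  let ?f1 = "\<lambda>e. ln (pmf \<nu> (fst e)) - ln (pmf \<nu> (fst e \<otimes> snd e))"
  let ?f2 = "\<lambda>e. len (fst e \<otimes> snd e) - len (fst e)"
  let ?f3 = "\<lambda>e::'a \<times> 'a. len (snd e) ^ 2"
  let ?D = "measure_pmf.expectation Q ?f1" and ?L = "measure_pmf.expectation Q ?f2"
  define k where "k = entropy_slope z"
  define s where "s = tanh z"
  have 1: "has_bochner_integral (count_space UNIV) (\<lambda>e. (?w e + (-1) * ?w (reverse e)) * ?f1 e) (2 * ?D)"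
    unfolding Q_def using ent[unfolded Q_def]
    by (intro has_integral_symmetrised[OF \<nu>]) (auto simp: m_assoc)
  have 2: "has_bochner_integral (count_space UNIV) (\<lambda>e. (?w e + (-1) * ?w (reverse e)) * ?f2 e) (2 * ?L)"
    unfolding Q_def using len[unfolded Q_def]
    by (intro has_integral_symmetrised[OF \<nu>]) (auto simp: m_assoc)
  have 3: "has_bochner_integral (count_space UNIV) (\<lambda>e. (?w e + 1 * ?w (reverse e)) * ?f3 e) (2 * measure_pmf.expectation Q ?f3)"
    unfolding Q_def using integrable_len_square_step
    by (intro has_integral_symmetrised[OF \<nu>]) (auto simp: len_inv integrable_pair_pmf_snd[where g="\<lambda>x. len x ^ 2"])
  have f3: "measure_pmf.expectation Q ?f3 = m2 ^ 2"
  proof -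
    have "measure_pmf.expectation Q ?f3 = measure_pmf.expectation (map_pmf snd Q) (\<lambda>x. len x ^ 2)" by simp
    also have "\<dots> = m2 ^ 2" by (simp add: Q_def map_snd_pair_pmf m2_def M2_eq)
    finally show ?thesis .
  qed
  have 4: "has_bochner_integral (count_space UNIV) (\<lambda>e. (?w e + 1 * ?w (reverse e)) * 1) (2 * measure_pmf.expectation Q (\<lambda>_. 1))"
    unfolding Q_def by (intro has_integral_symmetrised[OF \<nu>]) auto
  have lhs: "has_bochner_integral (count_space UNIV)
      (\<lambda>e. (?w e + ?w (reverse e)) * (z * s - k * s ^ 2) - (k * s ^ 2 / m2 ^ 2) * ((?w e + ?w (reverse e)) * ?f3 e)
        + (2 * k * s / m2) * ((?w e - ?w (reverse e)) * ?f2 e))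
      (2 * (z * s - k * s ^ 2) - (k * s ^ 2 / m2 ^ 2) * (2 * m2 ^ 2) + (2 * k * s / m2) * (2 * ?L))"
    using 2 3 4 unfolding f3
    by (intro has_bochner_integral_add has_bochner_integral_diff has_bochner_integral_mult_right has_bochner_integral_mult_left) auto
  have rhs: "has_bochner_integral (count_space UNIV) (\<lambda>e. ((?w e - ?w (reverse e)) * ?f1 e) / 2) (2 * ?D / 2)"
    using 1 by (intro has_bochner_integral_divide) auto
  have "2 * (z * s - k * s ^ 2) - (k * s ^ 2 / m2 ^ 2) * (2 * m2 ^ 2) + (2 * k * s / m2) * (2 * ?L) \<le> 2 * ?D / 2"
  proof (rule has_bochner_integral_mono[OF lhs rhs])
    fix e :: "'a \<times> 'a"
    show "(?w e + ?w (reverse e)) * (z * s - k * s ^ 2) - (k * s ^ 2 / m2 ^ 2) * ((?w e + ?w (reverse e)) * ?f3 e)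
        + (2 * k * s / m2) * ((?w e - ?w (reverse e)) * ?f2 e) \<le> ((?w e - ?w (reverse e)) * ?f1 e) / 2"
    proof (cases "?w e = 0 \<and> ?w (reverse e) = 0")
      case True
      then show ?thesis by simp
    next
      case False
      obtain x g where e: "e = (x, g)" by (cases e)
      have "e \<in> carrier G \<times> carrier G"
      proof (rule ccontr)
        assume "e \<notin> carrier G \<times> carrier G"
        then have "reverse e = e" "e \<notin> set_pmf Q" using \<nu> support by (auto simp: reverse_def Q_def)
        then show False using False by (simp add: set_pmf_iff)
      qed
      then have xg: "x \<in> carrier G" "g \<in> carrier G" by (auto simp: e)
      define A B where "A = pmf \<nu> x" and "B = pmf \<nu> (x \<otimes> g)"
      have w: "?w e = A * pmf \<mu> g" "?w (reverse e) = B * pmf \<mu> g"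
        using xg by (auto simp: Q_def e reverse_def pmf_pair A_def B_def symmetric_step)
      have "pmf \<mu> g \<noteq> 0" using False w by auto
      then have g: "g \<in> set_pmf \<mu>" "inv g \<in> set_pmf \<mu>" "0 < pmf \<mu> g"
        using xg symmetric_step by (auto simp: set_pmf_iff pmf_positive_iff)
      have "x \<in> set_pmf \<nu> \<longleftrightarrow> x \<otimes> g \<in> set_pmf \<nu>"
        using closed[of x g] closed[of "x \<otimes> g" "inv g"] g xg by (auto simp: m_assoc)
      then have AB: "0 < A" "0 < B"
        using False w by (auto simp: A_def B_def pmf_positive_iff set_pmf_iff)
      have "\<bar>?f2 e / m2\<bar> \<le> len g / m2"
        using abs_len_mult_diff_le[OF xg] m2 by (simp add: e divide_right_mono)
      then have "(A + B) * (z * s - k * s ^ 2 * (1 + (len g / m2) ^ 2)) + 2 * k * s * ((A - B) * (?f2 e / m2))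
          \<le> (A - B) * (ln A - ln B) / 2"
        unfolding s_def k_def by (rule ln_difference_tangent[OF AB z])
      then have "pmf \<mu> g * ((A + B) * (z * s - k * s ^ 2 * (1 + (len g / m2) ^ 2)) + 2 * k * s * ((A - B) * (?f2 e / m2)))
          \<le> pmf \<mu> g * ((A - B) * (ln A - ln B) / 2)"
        by (rule mult_left_mono) simp
      then show ?thesis
        unfolding w by (simp add: e A_def[symmetric] B_def[symmetric] algebra_simps power_divide add_divide_distrib diff_divide_distrib)
    qed
  qed
  then show ?thesis using m2 unfolding k_def[symmetric] s_def[symmetric]
    by (simp add: algebra_simps power2_eq_square)
qed

end

context metric_random_walk
begin

text \<open>
  The law of the walk at an independent geometric time of mean \<open>a / (1 - a)\<close>; up to the factor \<open>1 - a\<close>, this is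
  the Green function at \<open>a\<close>.
\<close>
definition green :: "real \<Rightarrow> 'a pmf" where
  "green a = bind_pmf (geometric_pmf (1 - a)) walk"

lemma set_green: "set_pmf (green a) \<subseteq> carrier G"
  using set_walk by (auto simp: green_def)

text \<open>
  With probability \<open>1 - a\<close> the geometric time is \<open>0\<close>; otherwise it is one more than a geometric time.
\<close>
lemma green_renewal:
  assumes a: "0 < a" "a < 1"
  shows "(\<integral>\<^sup>+x. f x \<partial>green a) = ennreal (1 - a) * f \<one> + ennreal a * (\<integral>\<^sup>+x. f x \<partial>conv_pmf G (green a) \<mu>)"
proof -
  have Suc: "walk (Suc n) = conv_pmf G (walk n) \<mu>" for n
    using conv_power_add[OF support, of n 1] by (simp add: conv_pmf_return_one support)
  have "(\<integral>\<^sup>+x. f x \<partial>green a) = (\<integral>\<^sup>+n. \<integral>\<^sup>+x. f x \<partial>walk n \<partial>geometric_pmf (1 - a))"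
    by (simp add: green_def)
  also have "\<dots> = ennreal (1 - a) * f \<one> + ennreal a * (\<integral>\<^sup>+n. \<integral>\<^sup>+x. f x \<partial>walk (Suc n) \<partial>geometric_pmf (1 - a))"
    using a by (subst geometric_bind_pmf_unfold)
      (auto simp del: conv_power.simps(2) simp: conv_power.simps(1) mult.commute)
  also have "(\<integral>\<^sup>+n. \<integral>\<^sup>+x. f x \<partial>walk (Suc n) \<partial>geometric_pmf (1 - a)) = (\<integral>\<^sup>+x. f x \<partial>conv_pmf G (green a) \<mu>)"
    unfolding Suc by (simp add: conv_pmf_def nn_integral_pair_pmf' green_def)
  finally show ?thesis .
qed

lemma integrable_green_step:
  fixes f :: "'a \<Rightarrow> real"
  assumes a: "0 < a" "a < 1" and f: "\<And>x. 0 \<le> f x" and int: "integrable (green a) f"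
  shows "integrable (conv_pmf G (green a) \<mu>) f"
    and "measure_pmf.expectation (conv_pmf G (green a) \<mu>) f = (measure_pmf.expectation (green a) f - (1 - a) * f \<one>) / a"
proof -
  have eq: "(\<integral>\<^sup>+x. ennreal (f x) \<partial>green a) = ennreal (1 - a) * ennreal (f \<one>)
      + ennreal a * (\<integral>\<^sup>+x. ennreal (f x) \<partial>conv_pmf G (green a) \<mu>)"
    by (rule green_renewal[OF a])
  have "ennreal a * (\<integral>\<^sup>+x. ennreal (f x) \<partial>conv_pmf G (green a) \<mu>) \<le> (\<integral>\<^sup>+x. ennreal (f x) \<partial>green a)"
    unfolding eq by simp
  also have "\<dots> = ennreal (measure_pmf.expectation (green a) f)"
    using f by (intro nn_integral_eq_integral int) simp
  finally have "ennreal a * (\<integral>\<^sup>+x. ennreal (f x) \<partial>conv_pmf G (green a) \<mu>) < \<top>"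
    by (simp add: le_less_trans)
  then have "(\<integral>\<^sup>+x. ennreal (f x) \<partial>conv_pmf G (green a) \<mu>) < \<top>"
    using a by (auto simp: ennreal_mult_less_top)
  then show int': "integrable (conv_pmf G (green a) \<mu>) f"
    using f by (intro integrableI_nonneg) auto
  have "ennreal (measure_pmf.expectation (green a) f) = ennreal ((1 - a) * f \<one> + a * measure_pmf.expectation (conv_pmf G (green a) \<mu>) f)"
    using eq int int' f a
    by (simp add: nn_integral_eq_integral ennreal_mult[symmetric] ennreal_plus[symmetric] del: ennreal_plus)
  then have "measure_pmf.expectation (green a) f = (1 - a) * f \<one> + a * measure_pmf.expectation (conv_pmf G (green a) \<mu>) f"
    using f a by (subst (asm) ennreal_inj) (auto intro!: add_nonneg_nonneg)
  then show "measure_pmf.expectation (conv_pmf G (green a) \<mu>) f = (measure_pmf.expectation (green a) f - (1 - a) * f \<one>) / a"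
    using a by (simp add: field_simps)
qed

lemma set_green_closed:
  assumes a: "0 < a" "a < 1" and "x \<in> set_pmf (green a)" "g \<in> set_pmf \<mu>"
  shows "x \<otimes> g \<in> set_pmf (green a)"
proof -
  obtain n where n: "x \<in> set_pmf (walk n)" using assms by (auto simp: green_def)
  have "x \<otimes> g \<in> set_pmf (conv_pmf G (walk n) \<mu>)"
    using n assms by (force simp: conv_pmf_def)
  also have "conv_pmf G (walk n) \<mu> = walk (Suc n)"
    using conv_power_add[OF support, of n 1] by (simp add: conv_pmf_return_one support)
  finally show ?thesis using a by (auto simp: green_def set_pmf_geometric simp del: conv_power.simps)
qed

lemma mean_len_le: "mean_len n \<le> real n * mean_len 1"
  by (rule subadditive_le_mult[OF mean_len_subadditive]) (simp add: mean_len_def)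

text \<open>
  The drift is the infimum of the normalised mean lengths, so the mean length of the Green measure is
  controlled from below for every \<open>a\<close>, with no error term.
\<close>
lemma drift_mult_le: "real n * drift G d \<mu> \<le> mean_len n"
  using drift_le[of n] mean_len_nonneg[of n] by (cases "n = 0") (auto simp: field_simps)

lemma green_len:
  assumes a: "0 < a" "a < 1"
  shows "integrable (green a) len"
    and "a / (1 - a) * drift G d \<mu> \<le> measure_pmf.expectation (green a) len"
proof -
  let ?g = "geometric_pmf (1 - a)"
  have geo: "integrable ?g real" "measure_pmf.expectation ?g real = a / (1 - a)"
    using a by (simp_all add: integrable_real_geometric_pmf expectation_geometric_pmf)
  have "(\<integral>\<^sup>+x. ennreal (len x) \<partial>walk n) = ennreal (mean_len n)" for n
    unfolding mean_len_def by (intro nn_integral_eq_integral integrable_len) simp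
  then have eq: "(\<integral>\<^sup>+x. ennreal (len x) \<partial>green a) = (\<integral>\<^sup>+n. ennreal (mean_len n) \<partial>?g)"
    by (simp add: green_def)
  have int: "integrable ?g mean_len"
  proof (rule Bochner_Integration.integrable_bound)
    show "integrable ?g (\<lambda>n. real n * mean_len 1)" using geo by simp
    show "AE n in ?g. norm (mean_len n) \<le> norm (real n * mean_len 1)"
      using mean_len_le mean_len_nonneg by (intro AE_pmfI) simp
  qed simp
  then have eq': "(\<integral>\<^sup>+x. ennreal (len x) \<partial>green a) = ennreal (measure_pmf.expectation ?g mean_len)"
    unfolding eq using mean_len_nonneg by (intro nn_integral_eq_integral) auto
  then show len: "integrable (green a) len" by (intro integrableI_nonneg) auto
  have "measure_pmf.expectation (green a) len = measure_pmf.expectation ?g mean_len"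
    using eq' len mean_len_nonneg by (simp add: nn_integral_eq_integral)
  moreover have "a / (1 - a) * drift G d \<mu> = measure_pmf.expectation ?g (\<lambda>n. real n * drift G d \<mu>)"
    using geo by simp
  moreover have "\<dots> \<le> measure_pmf.expectation ?g mean_len"
    using geo int drift_mult_le by (intro integral_mono) auto
  ultimately show "a / (1 - a) * drift G d \<mu> \<le> measure_pmf.expectation (green a) len" by simp
qed

end

context finite_entropy_walk
begin

text \<open>
  The mass of \<open>x\<close> under the Green measure is at least \<open>(1 - a) a\<^sup>n p\<^sub>n(x)\<close> for each \<open>n\<close>, so
  \<open>- ln\<close> of it is at most \<open>- ln p\<^sub>n(x) - ln (1 - a) - n ln a\<close>. Averaging over \<open>p\<^sub>n\<close> and over the geometric time
  gives the bound.
\<close>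
lemma green_entropy_le:
  assumes a: "0 < a" "a < 1" and bound: "\<And>n. walk_entropy n \<le> real n * b + C"
  shows "integrable (green a) (\<lambda>x. - ln (pmf (green a) x))"
    and "measure_pmf.expectation (green a) (\<lambda>x. - ln (pmf (green a) x)) \<le> C - ln (1 - a) + (b - ln a) * (a / (1 - a))"
proof -
  let ?g = "geometric_pmf (1 - a)"
  let ?u = "\<lambda>x. - ln (pmf (green a) x)"
  let ?R = "\<lambda>n. C - ln (1 - a) + (b - ln a) * real n"
  have geo: "integrable ?g real" "measure_pmf.expectation ?g real = a / (1 - a)"
    using a by (simp_all add: integrable_real_geometric_pmf expectation_geometric_pmf)
  have R0: "0 \<le> ?R n" for n
  proof -
    have "0 \<le> real n * b + C" using bound[of n] walk_entropy_nonneg[of n] by simp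
    moreover have "real n * ln a \<le> 0" using a by (intro mult_nonneg_nonpos) auto
    moreover have "ln (1 - a) \<le> 0" using a by simp
    ultimately show ?thesis by (simp add: algebra_simps)
  qed
  have inner: "(\<integral>\<^sup>+x. ennreal (?u x) \<partial>walk n) \<le> ennreal (?R n)" for n
  proof -
    have w: "pmf ?g n = a ^ n * (1 - a)" using a by simp
    have "(\<integral>\<^sup>+x. ennreal (?u x) \<partial>walk n) \<le> (\<integral>\<^sup>+x. ennreal (- ln (pmf ?g n)) + ennreal (- ln (pmf (walk n) x)) \<partial>walk n)"
    proof (intro nn_integral_mono_AE AE_pmfI)
      fix x assume "x \<in> set_pmf (walk n)"
      then have p: "0 < pmf (walk n) x" "0 < pmf ?g n" using a by (auto simp: pmf_positive)
      have "pmf ?g n * pmf (walk n) x \<le> pmf (green a) x"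
      proof -
        have "ennreal (pmf ?g n * pmf (walk n) x) = (\<integral>\<^sup>+m. ennreal (pmf (walk n) x) * indicator {n} m \<partial>?g)"
          by (subst nn_integral_cmult_indicator) (simp_all add: emeasure_pmf_single ennreal_mult mult.commute)
        also have "\<dots> \<le> (\<integral>\<^sup>+m. ennreal (pmf (walk m) x) \<partial>?g)"
          by (intro nn_integral_mono) (auto simp: indicator_def)
        also have "\<dots> = ennreal (pmf (green a) x)" by (simp add: green_def ennreal_pmf_bind)
        finally show ?thesis by simp
      qed
      then have "ln (pmf ?g n) + ln (pmf (walk n) x) \<le> ln (pmf (green a) x)"
        using p by (subst ln_mult_pos[symmetric]) (auto intro: ln_mono simp del: pmf_geometric)
      then have "ennreal (?u x) \<le> ennreal (- ln (pmf ?g n) + - ln (pmf (walk n) x))"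
        by (intro ennreal_leI) simp
      also have "\<dots> = ennreal (- ln (pmf ?g n)) + ennreal (- ln (pmf (walk n) x))"
        by (rule ennreal_plus[OF neg_ln_pmf_nonneg neg_ln_pmf_nonneg])
      finally show "ennreal (?u x) \<le> ennreal (- ln (pmf ?g n)) + ennreal (- ln (pmf (walk n) x))" .
    qed
    also have "\<dots> = ennreal (- ln (pmf ?g n)) + entropy_excess (walk n) 0"
      by (simp add: nn_integral_add entropy_excess_def del: pmf_geometric)
    also have "\<dots> = ennreal (- ln (pmf ?g n) + walk_entropy n)"
      unfolding ennreal_walk_entropy by (rule ennreal_plus[symmetric, OF neg_ln_pmf_nonneg walk_entropy_nonneg])
    also have "\<dots> \<le> ennreal (?R n)"
    proof (rule ennreal_leI)
      have "- ln (pmf ?g n) = - real n * ln a - ln (1 - a)"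
        unfolding w using a by (simp add: ln_mult_pos ln_realpow)
      then show "- ln (pmf ?g n) + walk_entropy n \<le> ?R n"
        using bound[of n] by (simp add: algebra_simps del: pmf_geometric)
    qed
    finally show ?thesis .
  qed
  have "(\<integral>\<^sup>+x. ennreal (?u x) \<partial>green a) = (\<integral>\<^sup>+n. \<integral>\<^sup>+x. ennreal (?u x) \<partial>walk n \<partial>?g)"
    unfolding green_def by (rule nn_integral_bind_pmf)
  also have "\<dots> \<le> (\<integral>\<^sup>+n. ennreal (?R n) \<partial>?g)"
    by (intro nn_integral_mono inner)
  also have "\<dots> = ennreal (measure_pmf.expectation ?g ?R)"
    using geo R0 by (intro nn_integral_eq_integral) auto
  also have "measure_pmf.expectation ?g ?R = C - ln (1 - a) + (b - ln a) * (a / (1 - a))"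
    using geo by simp
  finally have le: "(\<integral>\<^sup>+x. ennreal (?u x) \<partial>green a) \<le> ennreal (C - ln (1 - a) + (b - ln a) * (a / (1 - a)))" .
  show int: "integrable (green a) ?u"
    using le neg_ln_pmf_nonneg[of "green a"] by (intro integrableI_nonneg) (auto intro: le_less_trans)
  have "0 \<le> C - ln (1 - a) + (b - ln a) * (a / (1 - a))"
  proof -
    have "0 \<le> measure_pmf.expectation ?g ?R" using R0 by (rule Bochner_Integration.integral_nonneg)
    then show ?thesis using geo by simp
  qed
  then show "measure_pmf.expectation (green a) ?u \<le> C - ln (1 - a) + (b - ln a) * (a / (1 - a))"
    using le nn_integral_eq_integral[OF int] neg_ln_pmf_nonneg[of "green a"]
    by (simp del: neg_0_le_iff_le)
qed

text \<open>
  By the renewal equation, the step from the Green measure \<open>\<nu>\<close> to \<open>\<nu> * \<mu>\<close> increases the mean of a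
  nonnegative function \<open>f\<close> by \<open>(1/a - 1)\<close> times its mean under \<open>\<nu>\<close>, minus \<open>(1/a - 1) f(\<one>)\<close>.
  For the length \<open>f(\<one>) = 0\<close>, and for \<open>- ln \<nu>\<close> it is nonnegative.
\<close>
lemma entropy_drift_green:
  assumes a: "0 < a" "a < 1" and bound: "\<And>n. walk_entropy n \<le> real n * b + C"
    and m2: "0 < M2 G d \<mu>" and z: "0 < z"
  shows "2 * z * tanh z + 4 * entropy_slope z * tanh z * (drift G d \<mu> / M2 G d \<mu> - tanh z)
    \<le> (1 - a) / a * (C - ln (1 - a)) + (b - ln a)"
proof -
  let ?\<nu> = "green a"
  let ?Q = "pair_pmf ?\<nu> \<mu>"
  let ?u = "\<lambda>x. - ln (pmf ?\<nu> x)"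
  define H where "H = measure_pmf.expectation ?\<nu> ?u"
  define L where "L = measure_pmf.expectation ?\<nu> len"
  note u_int = green_entropy_le(1)[OF a bound]
  note u_conv = integrable_green_step[OF a neg_ln_pmf_nonneg u_int]
  note len_int = green_len(1)[OF a]
  note len_conv = integrable_green_step[OF a len_nonneg len_int]
  have Q: "conv_pmf G ?\<nu> \<mu> = map_pmf (\<lambda>e. fst e \<otimes> snd e) ?Q" "?\<nu> = map_pmf fst ?Q"
    by (simp_all add: conv_pmf_def case_prod_unfold map_fst_pair_pmf)
  have int: "integrable ?Q (\<lambda>e. ?u (fst e \<otimes> snd e))" "integrable ?Q (\<lambda>e. ?u (fst e))"
      "integrable ?Q (\<lambda>e. len (fst e \<otimes> snd e))" "integrable ?Q (\<lambda>e. len (fst e))"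
    using u_conv(1) len_conv(1) integrable_pair_pmf_fst[THEN iffD2, OF u_int]
      integrable_pair_pmf_fst[THEN iffD2, OF len_int]
    by (simp_all only: Q(1) integrable_map_pmf_eq)
  have ex: "measure_pmf.expectation ?Q (\<lambda>e. f (fst e)) = measure_pmf.expectation ?\<nu> f"
    "measure_pmf.expectation ?Q (\<lambda>e. f (fst e \<otimes> snd e)) = measure_pmf.expectation (conv_pmf G ?\<nu> \<mu>) f" for f :: "'a \<Rightarrow> real"
    using integral_map_pmf[of fst ?Q f] by (simp_all add: Q(1) map_fst_pair_pmf)
  have "measure_pmf.expectation ?Q (\<lambda>e. ln (pmf ?\<nu> (fst e)) - ln (pmf ?\<nu> (fst e \<otimes> snd e)))
      = measure_pmf.expectation ?Q (\<lambda>e. ?u (fst e \<otimes> snd e) - ?u (fst e))"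
    by (simp add: algebra_simps)
  also have "\<dots> = (H - (1 - a) * ?u \<one>) / a - H"
    using int(1,2) ex[of ?u] by (simp only: Bochner_Integration.integral_diff u_conv(2) H_def)
  also have "\<dots> \<le> (1 - a) / a * H"
  proof -
    have "0 \<le> (1 - a) * ?u \<one> / a" using a neg_ln_pmf_nonneg[of ?\<nu> \<one>] by (intro divide_nonneg_nonneg mult_nonneg_nonneg) auto
    then show ?thesis using a by (simp add: field_simps)
  qed
  also have "\<dots> \<le> (1 - a) / a * (C - ln (1 - a) + (b - ln a) * (a / (1 - a)))"
    unfolding H_def using a by (intro mult_left_mono green_entropy_le bound) auto
  also have "\<dots> = (1 - a) / a * (C - ln (1 - a)) + (b - ln a)"
    using a by (simp add: distrib_left)
  finally have upper: "measure_pmf.expectation ?Q (\<lambda>e. ln (pmf ?\<nu> (fst e)) - ln (pmf ?\<nu> (fst e \<otimes> snd e)))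
      \<le> (1 - a) / a * (C - ln (1 - a)) + (b - ln a)" .
  have "drift G d \<mu> = (1 - a) / a * (a / (1 - a) * drift G d \<mu>)" using a by simp
  also have "\<dots> \<le> (1 - a) / a * L"
    unfolding L_def using a by (intro mult_left_mono green_len) auto
  also have "\<dots> = (L - (1 - a) * len \<one>) / a - L" using a by (simp add: field_simps)
  also have "\<dots> = measure_pmf.expectation ?Q (\<lambda>e. len (fst e \<otimes> snd e) - len (fst e))"
    using int(3,4) ex[of len] by (simp only: Bochner_Integration.integral_diff len_conv(2) L_def)
  finally have lower: "drift G d \<mu> \<le> measure_pmf.expectation ?Q (\<lambda>e. len (fst e \<otimes> snd e) - len (fst e))" .
  have "2 * z * tanh z + 4 * entropy_slope z * tanh z * (drift G d \<mu> / M2 G d \<mu> - tanh z)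
      \<le> 2 * z * tanh z + 4 * entropy_slope z * tanh z *
        (measure_pmf.expectation ?Q (\<lambda>e. len (fst e \<otimes> snd e) - len (fst e)) / M2 G d \<mu> - tanh z)"
    using m2 z lower by (intro add_left_mono mult_left_mono diff_right_mono divide_right_mono)
      (auto simp: entropy_slope_def)
  also have "\<dots> \<le> measure_pmf.expectation ?Q (\<lambda>e. ln (pmf ?\<nu> (fst e)) - ln (pmf ?\<nu> (fst e \<otimes> snd e)))"
  proof (rule entropy_production_ge[OF set_green set_green_closed[OF a] _ _ m2 z])
    show "integrable ?Q (\<lambda>e. ln (pmf ?\<nu> (fst e)) - ln (pmf ?\<nu> (fst e \<otimes> snd e)))"
      using Bochner_Integration.integrable_diff[OF int(1,2)] by (simp add: algebra_simps)
    show "integrable ?Q (\<lambda>e. len (fst e \<otimes> snd e) - len (fst e))"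
      using Bochner_Integration.integrable_diff[OF int(3,4)] .
  qed
  finally show ?thesis using upper by linarith
qed

text \<open>
  Take \<open>b = h + \<delta>\<close> in the previous lemma and let \<open>a\<close> tend to \<open>1\<close>: then \<open>(1 - a) ln (1 - a)\<close> and \<open>ln a\<close> vanish.
  Since \<open>z\<close> is arbitrary, this says that \<open>F (\<ell> / m) \<le> h\<close> whenever \<open>\<ell> < m\<close>.
\<close>
lemma entropy_drift_tangent:
  assumes m2: "0 < M2 G d \<mu>" and z: "0 < z"
  shows "2 * z * tanh z + 4 * entropy_slope z * tanh z * (drift G d \<mu> / M2 G d \<mu> - tanh z) \<le> asymptotic_entropy G \<mu>"
proof (rule field_le_epsilon)
  fix \<delta> :: real assume \<delta>: "0 < \<delta>"
  let ?l = "2 * z * tanh z + 4 * entropy_slope z * tanh z * (drift G d \<mu> / M2 G d \<mu> - tanh z)"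
  define b where "b = asymptotic_entropy G \<mu> + \<delta>"
  have "\<forall>\<^sub>F n in sequentially. walk_entropy n / real n < b"
    using \<delta> by (intro order_tendstoD(2)[OF tendsto_asymptotic_entropy]) (simp add: b_def)
  then obtain N where N: "\<And>n. N \<le> n \<Longrightarrow> walk_entropy n / real n < b"
    by (auto simp: eventually_sequentially)
  have b0: "0 \<le> b"
  proof -
    have "0 \<le> walk_entropy (Suc N) / real (Suc N)" using walk_entropy_nonneg by simp
    then show ?thesis using N[of "Suc N"] by linarith
  qed
  define C where "C = (\<Sum>n<Suc N. walk_entropy n)"
  have bound: "walk_entropy n \<le> real n * b + C" for n
  proof (cases "n \<le> N")
    case True
    then have "walk_entropy n \<le> C"
      unfolding C_def using walk_entropy_nonneg by (intro member_le_sum) auto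
    then show ?thesis using b0 by (simp add: add_increasing)
  next
    case False
    then have "walk_entropy n \<le> real n * b" using N[of n] by (simp add: field_simps)
    moreover have "0 \<le> C" unfolding C_def by (intro sum_nonneg walk_entropy_nonneg)
    ultimately show ?thesis by simp
  qed
  have "((\<lambda>a. (1 - a) / a * (C - ln (1 - a)) + (b - ln a)) \<longlongrightarrow> b) (at_left 1)"
    by real_asymp
  moreover have "\<forall>\<^sub>F a in at_left 1. ?l \<le> (1 - a) / a * (C - ln (1 - a)) + (b - ln a)"
    using entropy_drift_green[OF _ _ bound m2 z] by (auto simp: eventually_at_left_field intro: exI[of _ 0])
  ultimately show "?l \<le> asymptotic_entropy G \<mu> + \<delta>"
    unfolding b_def[symmetric] by (intro tendsto_lowerbound) auto
qed

end

section \<open>Rayleigh quotients and the spectral radius\<close>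

context metric_random_walk
begin

lemma
  assumes "z \<in> carrier G"
  shows summable_walk_product: "(\<lambda>y. pmf (walk n) (inv y \<otimes> z) * pmf (walk m) y) summable_on carrier G"
    and pmf_walk_add: "pmf (walk (m + n)) z = (\<Sum>\<^sub>\<infinity>y\<in>carrier G. pmf (walk n) (inv y \<otimes> z) * pmf (walk m) y)"
proof -
  have "integrable (walk m) (\<lambda>y. pmf (walk n) (inv y \<otimes> z))"
    by (rule measure_pmf.integrable_const_bound[of _ 1]) (auto simp: pmf_le_1)
  then show "(\<lambda>y. pmf (walk n) (inv y \<otimes> z) * pmf (walk m) y) summable_on carrier G"
    by (rule summable_on_pmf_iff[OF set_walk, THEN iffD2])
  show "pmf (walk (m + n)) z = (\<Sum>\<^sub>\<infinity>y\<in>carrier G. pmf (walk n) (inv y \<otimes> z) * pmf (walk m) y)"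
    unfolding infsum_pmf[OF set_walk, of "\<lambda>y. pmf (walk n) (inv y \<otimes> z)"] conv_power_add[OF support]
    by (rule pmf_conv_pmf[OF set_walk set_walk assms])
qed

text \<open>
  By symmetry \<open>p\<^sub>2\<^sub>n(\<one>)\<close> is the sum of \<open>p\<^sub>n(y)\<^sup>2\<close>, and \<open>p\<^sub>2\<^sub>n(z)\<close> is a sum of products \<open>p\<^sub>n(y) p\<^sub>n(y\<^sup>-\<^sup>1 z)\<close>, to which
  the inequality between geometric and arithmetic mean applies.
\<close>
lemma pmf_walk_even_le:
  assumes z: "z \<in> carrier G"
  shows "pmf (walk (n + n)) z \<le> pmf (walk (n + n)) \<one>"
proof -
  let ?p = "pmf (walk n)"
  let ?S = "pmf (walk (n + n)) \<one>"
  have sq: "((\<lambda>x. ?p x ^ 2) has_sum ?S) (carrier G)"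
  proof -
    have "((\<lambda>x. ?p (inv x \<otimes> \<one>) * ?p x) has_sum ?S) (carrier G)"
      unfolding pmf_walk_add[OF one_closed]
      by (rule has_sum_infsum[OF summable_walk_product]) simp_all
    then show ?thesis
      by (rule has_sum_cong[THEN iffD1, rotated]) (simp add: symmetric_walk power2_eq_square)
  qed
  have "bij_betw (\<lambda>x. inv x \<otimes> z) (carrier G) (carrier G)"
    using z by (intro bij_betw_byWitness[where f'="\<lambda>y. z \<otimes> inv y"]) (auto simp: inv_mult_group m_assoc[symmetric], auto simp: m_assoc)
  then have sq': "((\<lambda>x. ?p (inv x \<otimes> z) ^ 2) has_sum ?S) (carrier G)"
    using sq by (subst has_sum_reindex_bij_betw[where g="\<lambda>x. inv x \<otimes> z" and f="\<lambda>x. ?p x ^ 2"])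
  have avg: "((\<lambda>x. (?p (inv x \<otimes> z) ^ 2 + ?p x ^ 2) / 2) has_sum ((?S + ?S) / 2)) (carrier G)"
    by (intro has_sum_divide_const has_sum_add sq sq')
  have prod: "((\<lambda>x. ?p (inv x \<otimes> z) * ?p x) has_sum pmf (walk (n + n)) z) (carrier G)"
    unfolding pmf_walk_add[OF z] by (rule has_sum_infsum[OF summable_walk_product[OF z]])
  have "pmf (walk (n + n)) z \<le> (?S + ?S) / 2"
  proof (rule has_sum_mono[OF prod avg])
    fix x
    show "?p (inv x \<otimes> z) * ?p x \<le> (?p (inv x \<otimes> z) ^ 2 + ?p x ^ 2) / 2"
      using sum_squares_bound[of "?p (inv x \<otimes> z)" "?p x"] by simp
  qed
  then show ?thesis by simp
qed

lemma finite_convolution_le: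
  assumes S: "finite S" "S \<subseteq> carrier G" and x: "x \<in> carrier G" and x': "x' \<in> carrier G"
  shows "(\<Sum>y\<in>S. pmf (walk n) (inv x \<otimes> y) * pmf (walk n) (inv x' \<otimes> y)) \<le> pmf (walk (n + n)) (inv x \<otimes> x')"
proof -
  let ?p = "pmf (walk n)"
  have inj: "inj_on (\<lambda>y. inv x \<otimes> y) S"
    by (rule inj_onI) (use S x in \<open>metis Units_l_cancel Units_eq inv_closed subsetD\<close>)
  have eq: "?p (inv x \<otimes> y) * ?p (inv x' \<otimes> y) = ?p (inv (inv x \<otimes> y) \<otimes> (inv x \<otimes> x')) * ?p (inv x \<otimes> y)" if "y \<in> S" for y
  proof -
    have y: "y \<in> carrier G" using that S by auto
    have "x \<otimes> (inv x \<otimes> x') = x'" using x x' by (simp add: m_assoc[symmetric])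
    then have "inv (inv x \<otimes> y) \<otimes> (inv x \<otimes> x') = inv y \<otimes> x'"
      using x x' y by (simp add: inv_mult_group m_assoc)
    also have "\<dots> = inv (inv x' \<otimes> y)" using x' y by (simp add: inv_mult_group)
    finally show ?thesis using symmetric_walk[of "inv x' \<otimes> y" n] x' y by simp
  qed
  have "(\<Sum>y\<in>S. ?p (inv x \<otimes> y) * ?p (inv x' \<otimes> y)) = (\<Sum>g\<in>(\<lambda>y. inv x \<otimes> y) ` S. ?p (inv g \<otimes> (inv x \<otimes> x')) * ?p g)"
    by (simp add: sum.reindex[OF inj] eq)
  also have "\<dots> \<le> (\<Sum>\<^sub>\<infinity>g\<in>carrier G. ?p (inv g \<otimes> (inv x \<otimes> x')) * ?p g)"
    using S x x' by (intro finite_sum_le_infsum summable_walk_product) auto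
  also have "\<dots> = pmf (walk (n + n)) (inv x \<otimes> x')"
    using x x' by (subst pmf_walk_add) auto
  finally show ?thesis .
qed

text \<open>
  Times that are powers of \<open>2\<close> suffice because the spectral radius is an upper limit.
\<close>
lemma spectral_radius_geI:
  assumes q: "0 \<le> q" and bound: "\<And>k. 0 < k \<Longrightarrow> q ^ (2 ^ k) \<le> K * pmf (walk (2 ^ k)) \<one>"
  shows "q \<le> spectral_radius G \<mu>"
proof -
  let ?r = "\<lambda>n. root n (pmf (walk n) \<one>)"
  define R where "R = limsup (\<lambda>n. ereal (?r n))"
  have "R \<le> ereal 1" unfolding R_def
  proof (rule Limsup_bounded, rule always_eventually, rule allI)
    fix n show "ereal (?r n) \<le> ereal 1" by (cases n) (simp_all add: pmf_le_1)
  qed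
  moreover have R0: "ereal 0 \<le> R" unfolding R_def
    by (rule order_trans[OF Liminf_bounded Liminf_le_Limsup]) (auto intro!: always_eventually real_root_ge_zero)
  ultimately have Rfin: "R = ereal (spectral_radius G \<mu>)"
    unfolding spectral_radius_def R_def[symmetric] by (cases R) auto
  show ?thesis
  proof (rule ccontr)
    assume "\<not> ?thesis"
    then have lt: "spectral_radius G \<mu> < q" by simp
    then obtain r where r: "spectral_radius G \<mu> < r" "r < q" using dense by blast
    have r0: "0 < r" using R0 r unfolding Rfin by simp
    have "R < ereal r" using r by (simp add: Rfin)
    then have "\<forall>\<^sub>F n in sequentially. ereal (?r n) < ereal r" unfolding R_def by (rule Limsup_lessD)
    then obtain n0 where n0: "\<And>n. n0 \<le> n \<Longrightarrow> ?r n < r" by (auto simp: eventually_sequentially)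
    have K0: "0 \<le> K"
    proof (rule ccontr)
      assume "\<not> 0 \<le> K"
      then have "K * pmf (walk (2 ^ 1)) \<one> \<le> 0" by (intro mult_nonpos_nonneg) auto
      moreover have "0 < q ^ (2 ^ 1)" using r r0 by (intro zero_less_power) simp
      ultimately show False using bound[of 1] by linarith
    qed
    have le_K: "(q / r) ^ n \<le> K" if n: "n = 2 ^ k" "n0 < k" for n k
    proof -
      have "k < n" using n less_exp by blast
      have "?r n ^ n \<le> r ^ n" using n0[of n] n \<open>k < n\<close> by (intro power_mono) auto
      moreover have "?r n ^ n = pmf (walk n) \<one>" using \<open>k < n\<close> by (intro real_root_pow_pos2) auto
      ultimately have "K * pmf (walk n) \<one> \<le> K * r ^ n" using K0 by (intro mult_left_mono) auto
      then have "q ^ n \<le> K * r ^ n" using bound[of k] n by simp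
      then show ?thesis using r0 by (simp add: power_divide field_simps)
    qed
    have "1 < q / r" using r r0 by simp
    then obtain k where "K < (q / r) ^ k" using real_arch_pow by blast
    moreover have "(q / r) ^ k \<le> (q / r) ^ (2 ^ (k + n0 + 1))"
    proof (rule power_increasing)
      show "k \<le> 2 ^ (k + n0 + 1)" using less_exp[of "k + n0 + 1"] by linarith
    qed (use \<open>1 < q / r\<close> in simp)
    moreover have "(q / r) ^ (2 ^ (k + n0 + 1)) \<le> K" by (rule le_K[OF refl]) simp
    ultimately show False by linarith
  qed
qed

text \<open>
  The inner product of \<open>P\<^sup>n f\<close> and \<open>f\<close>, where \<open>P\<close> is the convolution operator and \<open>f\<close> is extended by \<open>0\<close> outside
  the finite set \<open>S\<close>.
\<close>
definition quadratic_form :: "'a set \<Rightarrow> ('a \<Rightarrow> real) \<Rightarrow> nat \<Rightarrow> real" where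
  "quadratic_form S f n = (\<Sum>x\<in>S. \<Sum>y\<in>S. f x * f y * pmf (walk n) (inv x \<otimes> y))"

lemma quadratic_form_0:
  assumes "finite S" "S \<subseteq> carrier G"
  shows "quadratic_form S f 0 = (\<Sum>x\<in>S. f x ^ 2)"
  unfolding quadratic_form_def
proof (rule sum.cong[OF refl])
  fix x assume x: "x \<in> S"
  have "(\<Sum>y\<in>S. f x * f y * pmf (walk 0) (inv x \<otimes> y)) = (\<Sum>y\<in>S. if x = y then f x ^ 2 else 0)"
  proof (rule sum.cong[OF refl])
    fix y assume "y \<in> S"
    then have "inv x \<otimes> y = \<one> \<longleftrightarrow> x = y" using x assms
      by (metis inv_closed inv_equality inv_inv l_inv subsetD)
    then show "f x * f y * pmf (walk 0) (inv x \<otimes> y) = (if x = y then f x ^ 2 else 0)"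
      by (auto simp: power2_eq_square pmf_return)
  qed
  then show "(\<Sum>y\<in>S. f x * f y * pmf (walk 0) (inv x \<otimes> y)) = f x ^ 2"
    using x assms by simp
qed

text \<open>
  Cauchy-Schwarz bounds the square of the inner product of \<open>P\<^sup>n f\<close> and \<open>f\<close> by the product of the squared norms.
  The squared norm of \<open>P\<^sup>n f\<close>, restricted to \<open>S\<close>, is at most its norm on the whole group, which is the form at
  time \<open>2 n\<close> because \<open>P\<close> is self-adjoint.
\<close>
lemma quadratic_form_square_le:
  assumes S: "finite S" "S \<subseteq> carrier G" and f: "\<And>x. 0 \<le> f x"
  shows "quadratic_form S f n ^ 2 \<le> quadratic_form S f 0 * quadratic_form S f (n + n)"
proof -
  let ?p = "pmf (walk n)"
  define F where "F y = (\<Sum>x\<in>S. f x * ?p (inv x \<otimes> y))" for y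
  have "quadratic_form S f n = (\<Sum>y\<in>S. \<Sum>x\<in>S. f x * f y * ?p (inv x \<otimes> y))"
    unfolding quadratic_form_def by (rule sum.swap)
  also have "\<dots> = (\<Sum>y\<in>S. f y * F y)"
    by (simp add: F_def sum_distrib_left mult_ac)
  finally have "quadratic_form S f n ^ 2 \<le> (\<Sum>y\<in>S. f y ^ 2) * (\<Sum>y\<in>S. F y ^ 2)"
    using Cauchy_Schwarz_ineq_sum[of f F S] by simp
  also have "\<dots> \<le> quadratic_form S f 0 * quadratic_form S f (n + n)"
    unfolding quadratic_form_0[OF S]
  proof (intro mult_left_mono sum_nonneg)
    have "(\<Sum>y\<in>S. F y ^ 2) = (\<Sum>y\<in>S. \<Sum>x\<in>S. \<Sum>x'\<in>S. f x * f x' * (?p (inv x \<otimes> y) * ?p (inv x' \<otimes> y)))"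
      by (simp add: F_def power2_eq_square sum_product mult_ac)
    also have "\<dots> = (\<Sum>x\<in>S. \<Sum>y\<in>S. \<Sum>x'\<in>S. f x * f x' * (?p (inv x \<otimes> y) * ?p (inv x' \<otimes> y)))"
      by (rule sum.swap)
    also have "\<dots> = (\<Sum>x\<in>S. \<Sum>x'\<in>S. \<Sum>y\<in>S. f x * f x' * (?p (inv x \<otimes> y) * ?p (inv x' \<otimes> y)))"
      by (intro sum.cong refl sum.swap)
    also have "\<dots> = (\<Sum>x\<in>S. \<Sum>x'\<in>S. f x * f x' * (\<Sum>y\<in>S. ?p (inv x \<otimes> y) * ?p (inv x' \<otimes> y)))"
      by (simp add: sum_distrib_left)
    also have "\<dots> \<le> quadratic_form S f (n + n)"
      unfolding quadratic_form_def using S f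
      by (intro sum_mono mult_left_mono finite_convolution_le mult_nonneg_nonneg) auto
    finally show "(\<Sum>y\<in>S. F y ^ 2) \<le> quadratic_form S f (n + n)" .
  qed simp
  finally show ?thesis .
qed

text \<open>
  Iterating the preceding lemma shows that the \<open>2\<^sup>k\<close>-th power of the quotient is at most the normalised form at time
  \<open>2\<^sup>k\<close>, and the latter is at most a constant times the return probability. This replaces the spectral
  theorem.
\<close>
lemma rayleigh_quotient_le_spectral_radius:
  assumes S: "finite S" "S \<subseteq> carrier G" and f: "\<And>x. 0 \<le> f x" and pos: "0 < quadratic_form S f 0"
  shows "quadratic_form S f 1 / quadratic_form S f 0 \<le> spectral_radius G \<mu>"
proof (rule spectral_radius_geI)
  let ?a = "quadratic_form S f"
  let ?q = "?a 1 / ?a 0"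
  have nonneg: "0 \<le> ?a n" for n
    unfolding quadratic_form_def using f by (intro sum_nonneg mult_nonneg_nonneg) auto
  show q0: "0 \<le> ?q" using nonneg by simp
  have pow: "?q ^ (2 ^ k) \<le> ?a (2 ^ k) / ?a 0" for k
  proof (induction k)
    case (Suc k)
    have "?q ^ (2 ^ Suc k) = (?q ^ (2 ^ k)) ^ 2" by (simp add: power_mult[symmetric] mult.commute)
    also have "\<dots> \<le> (?a (2 ^ k) / ?a 0) ^ 2" using Suc q0 by (intro power_mono) auto
    also have "\<dots> = ?a (2 ^ k) ^ 2 / ?a 0 ^ 2" by (simp add: power_divide)
    also have "\<dots> \<le> ?a 0 * ?a (2 ^ k + 2 ^ k) / ?a 0 ^ 2"
      by (intro divide_right_mono quadratic_form_square_le S f) auto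
    also have "\<dots> = ?a (2 ^ Suc k) / ?a 0" using pos by (simp add: power2_eq_square mult_2)
    finally show ?case .
  qed simp
  show "?q ^ (2 ^ k) \<le> (\<Sum>x\<in>S. \<Sum>y\<in>S. f x * f y) / ?a 0 * pmf (walk (2 ^ k)) \<one>" if k: "0 < k" for k
  proof -
    obtain j where j: "k = Suc j" using k by (cases k) auto
    have "?a (2 ^ k) \<le> (\<Sum>x\<in>S. \<Sum>y\<in>S. f x * f y * pmf (walk (2 ^ k)) \<one>)"
      unfolding quadratic_form_def
    proof (intro sum_mono mult_left_mono mult_nonneg_nonneg f)
      fix x y assume "x \<in> S" "y \<in> S"
      then have "inv x \<otimes> y \<in> carrier G" using S by auto
      then show "pmf (walk (2 ^ k)) (inv x \<otimes> y) \<le> pmf (walk (2 ^ k)) \<one>"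
        using pmf_walk_even_le[of "inv x \<otimes> y" "2 ^ j"] by (simp add: j mult_2)
    qed
    then have "?a (2 ^ k) / ?a 0 \<le> (\<Sum>x\<in>S. \<Sum>y\<in>S. f x * f y) * pmf (walk (2 ^ k)) \<one> / ?a 0"
      using pos by (intro divide_right_mono) (auto simp: sum_distrib_right)
    then show ?thesis using pow[of k] by simp
  qed
qed

end

context growth_walk
begin

text \<open>
  The squared norm of the test function \<open>exp (- s \<bar>x\<bar>)\<close> restricted to the ball of radius \<open>r\<close>.
\<close>
definition exp_weight :: "real \<Rightarrow> real \<Rightarrow> real" where
  "exp_weight s r = (\<Sum>x\<in>ball r. exp (- s * len x) ^ 2)"

lemma exp_weight_ge_1: "0 \<le> r \<Longrightarrow> 1 \<le> exp_weight s r"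
  unfolding exp_weight_def
  using member_le_sum[of \<one> "ball r" "\<lambda>x. exp (- s * len x) ^ 2"] finite_ball[of r] one_in_ball[of r] by simp

lemma ball_subset_carrier: "ball r \<subseteq> carrier G" by (auto simp: ball_def)

text \<open>
  Only steps \<open>g\<close> of length at most \<open>R\<close> are kept, which costs nothing in the limit \<open>R \<rightarrow> \<infinity>\<close>. For such \<open>g\<close>, both the starting points \<open>x\<close>
  and the end points \<open>xg\<close> of the edges within the ball of radius \<open>N\<close> cover the ball of radius \<open>N - R\<close>.
\<close>
lemma quadratic_form_exp_ge:
  assumes s: "0 \<le> s"
  shows "exp_weight s (N - R) * (\<Sum>g\<in>ball R. pmf \<mu> g / cosh (s * len g))
    \<le> quadratic_form (ball N) (\<lambda>x. exp (- s * len x)) 1"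
proof -
  let ?S = "ball N"
  let ?f = "\<lambda>x. exp (- s * len x)"
  have inner: "exp_weight s (N - R) / cosh (s * len g) \<le> (\<Sum>x | x \<in> ?S \<and> x \<otimes> g \<in> ?S. ?f x * ?f (x \<otimes> g))"
    if g: "g \<in> ball R" for g
  proof -
    let ?X = "{x. x \<in> ?S \<and> x \<otimes> g \<in> ?S}"
    have fin: "finite ?X" using finite_ball[of N] by simp
    have g': "g \<in> carrier G" "len g \<le> R" using g by (auto simp: ball_def)
    have near: "x \<in> ?S \<and> x \<otimes> h \<in> ?S" if "x \<in> ball (N - R)" "h \<in> carrier G" "len h \<le> R" for x h
    proof -
      have "0 \<le> R" using that(3) len_nonneg[of h] by linarith
      then show ?thesis using that len_mult_le[of x h] by (auto simp: ball_def)
    qed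
    have 1: "exp_weight s (N - R) \<le> (\<Sum>x\<in>?X. ?f x ^ 2)"
      unfolding exp_weight_def using near[OF _ g'] fin by (intro sum_mono2) auto
    have 2: "exp_weight s (N - R) \<le> (\<Sum>x\<in>?X. ?f (x \<otimes> g) ^ 2)"
    proof -
      have inj: "inj_on (\<lambda>y. y \<otimes> inv g) (ball (N - R))"
        using g' by (auto simp: inj_on_def ball_def)
      have "exp_weight s (N - R) = (\<Sum>x\<in>(\<lambda>y. y \<otimes> inv g) ` ball (N - R). ?f (x \<otimes> g) ^ 2)"
        unfolding sum.reindex[OF inj] exp_weight_def using g'
        by (intro sum.cong) (auto simp: m_assoc ball_def)
      also have "\<dots> \<le> (\<Sum>x\<in>?X. ?f (x \<otimes> g) ^ 2)"
      proof (intro sum_mono2 fin)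
        have "y \<otimes> inv g \<in> ?X" if "y \<in> ball (N - R)" for y
          using near[OF that, of "inv g"] near[OF that, of g] g' that
          by (auto simp: len_inv m_assoc ball_def)
        then show "(\<lambda>y. y \<otimes> inv g) ` ball (N - R) \<subseteq> ?X" by auto
      qed auto
      finally show ?thesis .
    qed
    have "exp_weight s (N - R) / cosh (s * len g) = (exp_weight s (N - R) + exp_weight s (N - R)) / (2 * cosh (s * len g))"
      by simp
    also have "\<dots> \<le> ((\<Sum>x\<in>?X. ?f x ^ 2) + (\<Sum>x\<in>?X. ?f (x \<otimes> g) ^ 2)) / (2 * cosh (s * len g))"
      using 1 2 by (intro divide_right_mono add_mono) auto
    also have "\<dots> = (\<Sum>x\<in>?X. (?f x ^ 2 + ?f (x \<otimes> g) ^ 2) / (2 * cosh (s * len g)))"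
      by (simp add: sum.distrib sum_divide_distrib[symmetric])
    also have "\<dots> \<le> (\<Sum>x\<in>?X. ?f x * ?f (x \<otimes> g))"
    proof (intro sum_mono exp_product_ge s)
      fix x assume "x \<in> ?X"
      then have "x \<in> carrier G" by (auto simp: ball_def)
      then show "\<bar>len x - len (x \<otimes> g)\<bar> \<le> len g" using abs_len_mult_diff_le[OF _ g'(1), of x] by simp
    qed
    finally show ?thesis .
  qed
  have "exp_weight s (N - R) * (\<Sum>g\<in>ball R. pmf \<mu> g / cosh (s * len g))
      = (\<Sum>g\<in>ball R. pmf \<mu> g * (exp_weight s (N - R) / cosh (s * len g)))"
    by (simp add: sum_distrib_left mult_ac)
  also have "\<dots> \<le> (\<Sum>g\<in>ball R. pmf \<mu> g * (\<Sum>x | x \<in> ?S \<and> x \<otimes> g \<in> ?S. ?f x * ?f (x \<otimes> g)))"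
    by (intro sum_mono mult_left_mono inner) auto
  also have "\<dots> = (\<Sum>g\<in>ball R. \<Sum>x\<in>?S. if x \<otimes> g \<in> ?S then ?f x * ?f (x \<otimes> g) * pmf \<mu> g else 0)"
    using finite_ball[of N]
    by (intro sum.cong refl) (simp add: sum_distrib_left sum.If_cases Int_def mult_ac)
  also have "\<dots> = (\<Sum>x\<in>?S. \<Sum>g\<in>ball R. if x \<otimes> g \<in> ?S then ?f x * ?f (x \<otimes> g) * pmf \<mu> g else 0)"
    by (rule sum.swap)
  also have "\<dots> \<le> (\<Sum>x\<in>?S. \<Sum>y\<in>?S. ?f x * ?f y * pmf \<mu> (inv x \<otimes> y))"
  proof (intro sum_mono)
    fix x assume x: "x \<in> ?S"
    then have xc: "x \<in> carrier G" by (simp add: ball_def)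
    let ?B = "{g \<in> ball R. x \<otimes> g \<in> ?S}"
    have inj: "inj_on (\<lambda>g. x \<otimes> g) ?B" using xc by (auto simp: inj_on_def ball_def)
    have "(\<Sum>g\<in>ball R. if x \<otimes> g \<in> ?S then ?f x * ?f (x \<otimes> g) * pmf \<mu> g else 0)
        = (\<Sum>g\<in>?B. ?f x * ?f (x \<otimes> g) * pmf \<mu> g)"
      using finite_ball[of R] by (simp add: sum.If_cases Int_def)
    also have "\<dots> = (\<Sum>y\<in>(\<lambda>g. x \<otimes> g) ` ?B. ?f x * ?f y * pmf \<mu> (inv x \<otimes> y))"
      unfolding sum.reindex[OF inj] using xc
      by (intro sum.cong) (auto simp: m_assoc[symmetric] ball_def)
    also have "\<dots> \<le> (\<Sum>y\<in>?S. ?f x * ?f y * pmf \<mu> (inv x \<otimes> y))"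
      using finite_ball[of N] by (intro sum_mono2) auto
    finally show "(\<Sum>g\<in>ball R. if x \<otimes> g \<in> ?S then ?f x * ?f (x \<otimes> g) * pmf \<mu> g else 0)
        \<le> (\<Sum>y\<in>?S. ?f x * ?f y * pmf \<mu> (inv x \<otimes> y))" .
  qed
  also have "\<dots> = quadratic_form ?S ?f 1"
    unfolding quadratic_form_def conv_power_1[OF support] ..
  finally show ?thesis .
qed

text \<open>
  If for every \<open>N\<close> the shell between the radii \<open>N - R\<close> and \<open>N\<close> carried more than the proportion \<open>\<delta>\<close> of the
  weight, it would carry at least \<open>\<delta>\<close>. As the weight of a point of the shell is at most \<open>exp (- 2 s (N - R))\<close>, every ball of
  radius \<open>N\<close> would have at least \<open>\<delta> exp (2 s (N - R))\<close> elements, contradicting that the lower growth rate \<open>v\<close> is less than \<open>2 s\<close>.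
  Radii from the subsequence with small balls need not have thin shells themselves, and the sum
  of \<open>exp (- 2 s \<bar>x\<bar>)\<close> over the group can diverge, so the radius cannot be chosen more directly.
\<close>
lemma exists_thin_shell:
  assumes s: "v < 2 * s" and \<delta>: "0 < \<delta>"
  shows "\<exists>N::nat. (1 - \<delta>) * exp_weight s (real N) \<le> exp_weight s (real N - R)"
proof (rule ccontr)
  assume "\<not> ?thesis"
  then have thick: "exp_weight s (real N - R) < (1 - \<delta>) * exp_weight s (real N)" for N :: nat
    by (simp add: not_le)
  have s0: "0 < s" using s growth_nonneg by simp
  obtain b where b: "v < b" "b < 2 * s" using dense[OF s] by blast
  obtain n0 where n0: "2 * s * \<bar>R\<bar> - ln \<delta> < real n0 * (2 * s - b)"
    using reals_Archimedean3[of "2 * s - b"] b by auto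
  obtain N where N: "n0 \<le> N" "ln (real (card (ball (real N)))) \<le> b * real N"
    using frequently_small_ball[OF b(1)] by blast
  let ?B = "ball (real N)"
  have "\<delta> \<le> \<delta> * exp_weight s (real N)" using \<delta> exp_weight_ge_1[of "real N" s] by simp
  also have "\<dots> < exp_weight s (real N) - exp_weight s (real N - R)"
    using thick[of N] by (simp add: algebra_simps)
  also have "\<dots> \<le> exp_weight s (real N) - (\<Sum>x\<in>?B \<inter> ball (real N - R). exp (- s * len x) ^ 2)"
    unfolding exp_weight_def using finite_ball by (intro diff_left_mono sum_mono2) auto
  also have "\<dots> = (\<Sum>x\<in>?B - ball (real N - R). exp (- s * len x) ^ 2)"
    unfolding exp_weight_def
    using sum.Int_Diff[OF finite_ball[of "real N"], of "\<lambda>x. exp (- s * len x) ^ 2" "ball (real N - R)"] by simp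
  also have "\<dots> \<le> (\<Sum>x\<in>?B - ball (real N - R). exp (- 2 * s * (real N - R)))"
  proof (rule sum_mono)
    fix x assume "x \<in> ?B - ball (real N - R)"
    then have "real N - R < len x" by (auto simp: ball_def)
    then have "exp (- 2 * s * len x) \<le> exp (- 2 * s * (real N - R))" using s0 by simp
    then show "exp (- s * len x) ^ 2 \<le> exp (- 2 * s * (real N - R))"
      by (simp add: power2_eq_square exp_add[symmetric])
  qed
  also have "\<dots> \<le> real (card ?B) * exp (- 2 * s * (real N - R))"
    using finite_ball[of "real N"] by (auto intro!: mult_right_mono card_mono)
  finally have "ln \<delta> \<le> ln (real (card ?B) * exp (- 2 * s * (real N - R)))"
    using \<delta> by (intro ln_mono) auto
  also have "\<dots> = ln (real (card ?B)) - 2 * s * (real N - R)"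
    using card_ball_pos[of "real N"] by (simp add: ln_mult_pos)
  also have "\<dots> \<le> b * real N - 2 * s * (real N - R)" using N by simp
  finally have "real N * (2 * s - b) \<le> 2 * s * R - ln \<delta>" by (simp add: algebra_simps)
  also have "\<dots> \<le> 2 * s * \<bar>R\<bar> - ln \<delta>" using s0 by (simp add: mult_left_mono)
  also have "\<dots> < real n0 * (2 * s - b)" by (rule n0)
  also have "\<dots> \<le> real N * (2 * s - b)" using N b by (intro mult_right_mono) auto
  finally show False by simp
qed

lemma sum_sech_le_spectral_radius:
  assumes s: "v < 2 * s"
  shows "(\<Sum>g\<in>ball R. pmf \<mu> g / cosh (s * len g)) \<le> spectral_radius G \<mu>"
proof (rule field_le_epsilon)
  let ?E = "\<Sum>g\<in>ball R. pmf \<mu> g / cosh (s * len g)"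
  have s0: "0 \<le> s" using s growth_nonneg by simp
  have E0: "0 \<le> ?E" by (intro sum_nonneg divide_nonneg_nonneg) auto
  have E1: "?E \<le> 1"
  proof -
    have "?E \<le> (\<Sum>g\<in>ball R. pmf \<mu> g)"
    proof (rule sum_mono)
      fix g
      have "pmf \<mu> g * 1 \<le> pmf \<mu> g * cosh (s * len g)" by (intro mult_left_mono cosh_real_ge_1) auto
      then show "pmf \<mu> g / cosh (s * len g) \<le> pmf \<mu> g" by (simp add: pos_divide_le_eq cosh_real_pos)
    qed
    also have "\<dots> \<le> 1" using finite_ball by (simp add: measure_measure_pmf_finite[symmetric])
    finally show ?thesis .
  qed
  fix \<delta> :: real assume \<delta>: "0 < \<delta>"
  obtain N :: nat where N: "(1 - \<delta>) * exp_weight s (real N) \<le> exp_weight s (real N - R)"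
    using exists_thin_shell[OF s \<delta>] by blast
  let ?f = "\<lambda>x. exp (- s * len x)"
  have W: "quadratic_form (ball (real N)) ?f 0 = exp_weight s (real N)" "1 \<le> exp_weight s (real N)"
    using exp_weight_ge_1[of "real N" s] by (simp_all add: quadratic_form_0 finite_ball ball_subset_carrier exp_weight_def)
  have "(1 - \<delta>) * ?E \<le> exp_weight s (real N - R) / exp_weight s (real N) * ?E"
    using N W(2) E0 by (intro mult_right_mono) (auto simp: le_divide_eq)
  also have "\<dots> \<le> quadratic_form (ball (real N)) ?f 1 / quadratic_form (ball (real N)) ?f 0"
    using quadratic_form_exp_ge[OF s0, of "real N" R] W by (simp add: divide_right_mono)
  also have "\<dots> \<le> spectral_radius G \<mu>"
    using W by (intro rayleigh_quotient_le_spectral_radius finite_ball ball_subset_carrier) auto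
  finally have "?E - \<delta> * ?E \<le> spectral_radius G \<mu>" by (simp add: algebra_simps)
  moreover have "\<delta> * ?E \<le> \<delta>" using \<delta> E1 by simp
  ultimately show "?E \<le> spectral_radius G \<mu> + \<delta>" by linarith
qed

lemma sech_le_spectral_radius:
  assumes s: "v < 2 * s" and m2: "0 < M2 G d \<mu>"
  shows "1 / cosh (s * M2 G d \<mu>) \<le> spectral_radius G \<mu>"
proof -
  define z where "z = s * M2 G d \<mu>"
  have s0: "0 < s" using s growth_nonneg by simp
  have z: "0 < z" using s0 m2 by (simp add: z_def)
  let ?h = "\<lambda>g. 1 / cosh (s * len g)"
  have h1: "?h g \<le> 1" for g using cosh_real_ge_1[of "s * len g"] by simp
  have int: "integrable \<mu> ?h"
    by (rule measure_pmf.integrable_const_bound[of _ 1]) (auto simp: h1)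
  let ?k = "tanh z / (2 * z * cosh z)"
  have sq: "measure_pmf.expectation \<mu> (\<lambda>g. len g ^ 2) = M2 G d \<mu> ^ 2" by (simp add: M2_eq)
  have "1 / cosh z = measure_pmf.expectation \<mu> (\<lambda>g. 1 / cosh z - ?k * (s ^ 2 * len g ^ 2 - z ^ 2))"
    using integrable_len_square_step sq by (simp add: z_def power_mult_distrib)
  also have "\<dots> \<le> measure_pmf.expectation \<mu> ?h"
  proof (rule integral_mono)
    show "1 / cosh z - ?k * (s ^ 2 * len g ^ 2 - z ^ 2) \<le> ?h g" for g
      using sech_tangent[OF z, of "s * len g"] by (simp add: power_mult_distrib)
  qed (use integrable_len_square_step int in auto)
  also have "\<dots> \<le> spectral_radius G \<mu>"
  proof (rule LIMSEQ_le_const2)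
    show "(\<lambda>R. measure_pmf.expectation \<mu> (\<lambda>g. indicator (ball (real R)) g * ?h g)) \<longlonglongrightarrow> measure_pmf.expectation \<mu> ?h"
    proof (rule integral_dominated_convergence[where w="\<lambda>_. 1"])
      show "AE g in \<mu>. (\<lambda>R. indicator (ball (real R)) g * ?h g) \<longlonglongrightarrow> ?h g"
      proof (intro AE_pmfI tendsto_eventually)
        fix g assume "g \<in> set_pmf \<mu>"
        then have g: "g \<in> carrier G" using set_walkD(2) by blast
        show "\<forall>\<^sub>F R in sequentially. indicator (ball (real R)) g * ?h g = ?h g"
          using eventually_ge_at_top[of "nat \<lceil>len g\<rceil>"]
          by eventually_elim (use g in \<open>simp add: ball_def nat_le_iff ceiling_le_iff\<close>)
      qed
    qed (auto simp: indicator_def cosh_real_ge_1)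
    have "measure_pmf.expectation \<mu> (\<lambda>g. indicator (ball (real R)) g * ?h g) = (\<Sum>g\<in>ball (real R). pmf \<mu> g / cosh (s * len g))" for R :: nat
      by (subst integral_measure_pmf_real[OF finite_ball[of "real R"]])
        (auto simp: indicator_def split: if_splits)
    then show "\<exists>N. \<forall>n\<ge>N. measure_pmf.expectation \<mu> (\<lambda>g. indicator (ball (real n)) g * ?h g) \<le> spectral_radius G \<mu>"
      using sum_sech_le_spectral_radius[OF s] by simp
  qed
  finally show ?thesis by (simp add: z_def)
qed

end

section \<open>The sharp bounds\<close>

lemma (in metric_random_walk) M2_pos:
  assumes "\<mu> \<noteq> return_pmf \<one>"
  shows "0 < M2 G d \<mu>"
proof -
  have "measure_pmf.expectation \<mu> (\<lambda>x. len x ^ 2) \<noteq> 0"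
  proof
    assume "measure_pmf.expectation \<mu> (\<lambda>x. len x ^ 2) = 0"
    then have "AE x in \<mu>. len x ^ 2 = 0"
      using integral_nonneg_eq_0_iff_AE[OF integrable_len_square_step] by simp
    then have "len x = 0" if "x \<in> set_pmf \<mu>" for x
      using that by (simp add: AE_measure_pmf_iff)
    then have "set_pmf \<mu> \<subseteq> {\<one>}"
      using len_pos set_walkD(2) by force
    then show False using assms by (simp add: set_pmf_subset_singleton)
  qed
  then show ?thesis by (simp add: M2_eq order_less_le)
qed

context entropy_growth_walk
begin

text \<open>
  For \<open>z > m v / 2\<close>, the tangent bound on \<open>h\<close> from below and \<open>h \<le> \<ell> v \<le> 2 z \<ell> / m\<close> give
  \<open>F' (tanh z) (\<ell> / m - tanh z) \<le> 2 z (\<ell> / m - tanh z)\<close>, while the slope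
  \<open>F' (tanh z) = 2 z + 2 cosh\<^sup>2 z tanh z\<close> exceeds \<open>2 z\<close>. Working with \<open>z\<close> slightly larger than \<open>m v / 2\<close> also covers
  the case \<open>v = 0\<close>, where the slope degenerates.
\<close>
lemma drift_le_tanh:
  assumes m2: "0 < M2 G d \<mu>"
  shows "drift G d \<mu> / M2 G d \<mu> \<le> tanh (M2 G d \<mu> * v / 2)"
proof -
  define l where "l = drift G d \<mu> / M2 G d \<mu>"
  define w where "w = M2 G d \<mu> * v"
  have l0: "0 \<le> l" using drift_nonneg m2 by (simp add: l_def)
  have w0: "0 \<le> w" using growth_nonneg m2 by (simp add: w_def)
  have "l \<le> tanh z" if z: "w / 2 < z" for z
  proof (rule ccontr)
    assume "\<not> ?thesis"
    then have lt: "0 < l - tanh z" by simp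
    have z0: "0 < z" using z w0 by simp
    have "2 * z * tanh z + 4 * entropy_slope z * tanh z * (l - tanh z) \<le> asymptotic_entropy G \<mu>"
      unfolding l_def by (rule entropy_drift_tangent[OF m2 z0])
    also have "\<dots> \<le> w * l"
      using asymptotic_entropy_le_drift_growth m2 by (simp add: w_def l_def mult.commute)
    also have "\<dots> \<le> 2 * z * l" using z l0 by (intro mult_right_mono) auto
    finally have "4 * entropy_slope z * tanh z * (l - tanh z) \<le> 2 * z * (l - tanh z)"
      by (simp add: algebra_simps)
    then have "4 * entropy_slope z * tanh z \<le> 2 * z" using lt by simp
    moreover have "4 * entropy_slope z * tanh z = 2 * z + 2 * cosh z ^ 2 * tanh z"
      using z0 by (simp add: entropy_slope_def field_simps)
    moreover have "0 < 2 * cosh z ^ 2 * tanh z" using z0 by simp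
    ultimately show False by linarith
  qed
  then have "\<forall>\<^sub>F z in at_right (w / 2). l \<le> tanh z"
    by (auto simp: eventually_at_right_field intro: exI[of _ "w / 2 + 1"])
  moreover have "(tanh \<longlongrightarrow> tanh (w / 2)) (at_right (w / 2))"
    by (intro tendsto_intros) auto
  ultimately have "l \<le> tanh (w / 2)" by (intro tendsto_lowerbound[of tanh]) auto
  then show ?thesis by (simp add: l_def w_def)
qed

lemma asymptotic_entropy_le_tanh:
  assumes m2: "0 < M2 G d \<mu>"
  shows "asymptotic_entropy G \<mu> \<le> M2 G d \<mu> * v * tanh (M2 G d \<mu> * v / 2)"
proof -
  have "asymptotic_entropy G \<mu> \<le> M2 G d \<mu> * v * (drift G d \<mu> / M2 G d \<mu>)"
    using asymptotic_entropy_le_drift_growth m2 by simp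
  also have "\<dots> \<le> M2 G d \<mu> * v * tanh (M2 G d \<mu> * v / 2)"
    using m2 growth_nonneg by (intro mult_left_mono drift_le_tanh) auto
  finally show ?thesis .
qed

end

lemma (in growth_walk) spectral_radius_ge_sech:
  assumes m2: "0 < M2 G d \<mu>"
  shows "1 / cosh (M2 G d \<mu> * v / 2) \<le> spectral_radius G \<mu>"
proof -
  have "((\<lambda>s. 1 / cosh (s * M2 G d \<mu>)) \<longlongrightarrow> 1 / cosh (v / 2 * M2 G d \<mu>)) (at_right (v / 2))"
    by (intro tendsto_intros) auto
  moreover have "\<forall>\<^sub>F s in at_right (v / 2). 1 / cosh (s * M2 G d \<mu>) \<le> spectral_radius G \<mu>"
    using sech_le_spectral_radius[OF _ m2] by (auto simp: eventually_at_right_field intro: exI[of _ "v / 2 + 1"])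
  ultimately have "1 / cosh (v / 2 * M2 G d \<mu>) \<le> spectral_radius G \<mu>"
    by (intro tendsto_upperbound) auto
  then show ?thesis by (simp add: mult.commute)
qed

theorem theorem1p1:
  fixes G :: "('a, 'b) monoid_scheme"
    and d :: "'a \<Rightarrow> 'a \<Rightarrow> real"
    and \<mu> :: "'a pmf"
    and v :: real
  assumes "group G"
    and "countable (carrier G)"
    and "Metric_space (carrier G) d"
    and "proper_dist G d"
    and "left_invariant_dist G d"
    and "growth G d = ereal v"
    and "set_pmf \<mu> \<subseteq> carrier G"
    and "\<mu> \<noteq> return_pmf \<one>\<^bsub>G\<^esub>"
    and "symmetric_pmf G \<mu>"
    and "finite_second_moment G d \<mu>"
    and "finite_entropy G \<mu>"
  shows "let l' = drift G d \<mu> / M2 G d \<mu>;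
             v' = M2 G d \<mu> * v
         in l' \<le> tanh (v' / 2)
          \<and> asymptotic_entropy G \<mu> \<le> v' * tanh (v' / 2)
          \<and> spectral_radius G \<mu> \<ge> 1 / cosh (v' / 2)"
proof -
  interpret group G by fact
  interpret Metric_space "carrier G" d by fact
  interpret entropy_growth_walk G d \<mu> v by unfold_locales fact+
  show ?thesis
    using drift_le_tanh asymptotic_entropy_le_tanh spectral_radius_ge_sech M2_pos[OF assms(8)]
    by (simp add: Let_def)
qed

end
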